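(* For every integer $d \geq 1$ there exists a constant $c_d > 0$, depending only on $d$, such that for every integer $N \geq 1$, all points $x_1, \dots, x_N \in [0,1]^d$ and every Lipschitz function $f:[0,1]^d \rightarrow \mathbb{R}$, $$ \left| \int_{[0,1]^d} f(x)\, dx - \frac{1}{N} \sum_{k=1}^{N} f(x_k) \right| \leq c_d \cdot \|\nabla f\|_{L^{\infty}([0,1]^d)}^{\frac{d-1}{d}} \cdot \|\nabla f\|_{L^{1}([0,1]^d)}^{\frac{1}{d}} \cdot N^{1/d} \cdot W_{\infty}\left(dx, \frac{1}{N} \sum_{k=1}^{N}\delta_{x_k} \right)^2. $$
   Context: Here $dx$ denotes Lebesgue measure on $[0,1]^d$, $\delta_{x}$ is the Dirac measure at $x$, and $\|\nabla f\|_{L^p}$ is the $L^p$ norm of the (almost everywhere defined) function $x \mapsto \|\nabla f(x)\|$, with $\|\cdot\|$ the Euclidean norm. $W_\infty(\mu,\nu)$ is the $\infty$-Wasserstein distance with respect to the Euclidean distance: for Borel probability measures $\mu,\nu$ on $[0,1]^d$, it is the infimum over all couplings $\pi$ of $\mu$ and $\nu$ of the $\pi$-essential supremum of $\|x-y\|$. *)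

theory Defs
  imports "HOL-Probability.Probability"
begin

abbreviation unit_cube :: "(real ^ 'n) set"
  where "unit_cube \<equiv> cbox 0 1"

section \<open>Gradient and its norms\<close>

text \<open>The derivative is taken within the domain, so that the gradient depends only on the values
  of the function there. On the unit cube a gradient is unique where it exists, including at
  boundary points. The value \<open>0\<close> at points of non-differentiability is a dummy: for a Lipschitz
  function these points form a null set.\<close>

definition gradient_on :: "'a::real_inner set \<Rightarrow> ('a \<Rightarrow> real) \<Rightarrow> 'a \<Rightarrow> 'a"
  where "gradient_on S f x =
    (if \<exists>D. (f has_derivative (\<lambda>h. h \<bullet> D)) (at x within S)
     then SOME D. (f has_derivative (\<lambda>h. h \<bullet> D)) (at x within S)
     else 0)"

definition L1_norm :: "'a measure \<Rightarrow> ('a \<Rightarrow> real) \<Rightarrow> real"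
  where "L1_norm M g = (LINT x|M. \<bar>g x\<bar>)"

definition Linf_norm :: "'a measure \<Rightarrow> ('a \<Rightarrow> real) \<Rightarrow> real"
  where "Linf_norm M g = enn2real (esssup M (\<lambda>x. ennreal \<bar>g x\<bar>))"

section \<open>The \<open>\<infinity>\<close>-Wasserstein distance\<close>

definition couplings :: "'a measure \<Rightarrow> 'b measure \<Rightarrow> ('a \<times> 'b) measure set"
  where "couplings \<mu> \<nu> = {\<pi>. sets \<pi> = sets (\<mu> \<Otimes>\<^sub>M \<nu>) \<and> distr \<pi> \<mu> fst = \<mu> \<and> distr \<pi> \<nu> snd = \<nu>}"

definition W_inf :: "'a::real_normed_vector measure \<Rightarrow> 'a measure \<Rightarrow> ennreal"
  where "W_inf \<mu> \<nu> = (INF \<pi>\<in>couplings \<mu> \<nu>. esssup \<pi> (\<lambda>(x, y). ennreal (norm (x - y))))"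

section \<open>Measures on the unit cube\<close>

text \<open>The Wasserstein distance is taken between Borel measures on the cube. The norms of the
  gradient use the completed Lebesgue measure instead, since the gradient of a Lipschitz function
  is only determined up to null sets.\<close>

definition cube_measure :: "(real ^ 'n) measure"
  where "cube_measure = restrict_space lborel unit_cube"

definition empirical_measure :: "nat \<Rightarrow> (nat \<Rightarrow> real ^ 'n) \<Rightarrow> (real ^ 'n) measure"
  where "empirical_measure N x =
    measure_of unit_cube (sets (restrict_space borel unit_cube))
      (\<lambda>A. (\<Sum>k=1..N. emeasure (return (restrict_space borel unit_cube) (x k)) A) / of_nat N)"

lemma space_cube_measure [simp]: "space cube_measure = unit_cube"
  by (simp add: cube_measure_def space_restrict_space)

lemma sets_cube_measure [simp, measurable_cong]:
  "sets cube_measure = sets (restrict_space borel unit_cube)"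
  by (simp add: cube_measure_def sets_restrict_space)

lemma space_empirical_measure [simp]: "space (empirical_measure N x) = unit_cube"
  unfolding empirical_measure_def
  by (rule space_measure_of) (metis sets.space_closed space_restrict_space2 sets_borel space_borel
      closed_cbox borel_closed)

lemma sets_empirical_measure [simp, measurable_cong]:
  "sets (empirical_measure N x) = sets (restrict_space borel unit_cube)"
  unfolding empirical_measure_def
  using sets.sets_measure_of_eq[of "restrict_space borel unit_cube"]
  by (simp add: space_restrict_space)

text \<open>The set function in the definition is countably additive, so \<^const>\<open>measure_of\<close> does not
  fall back to the zero measure.\<close>

lemma emeasure_empirical_measure:
  assumes "A \<in> sets (restrict_space borel (unit_cube :: (real ^ 'n) set))"
  shows "emeasure (empirical_measure N x) A =
    (\<Sum>k=1..N. emeasure (return (restrict_space borel unit_cube) (x k)) A) / of_nat N"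
proof (rule emeasure_measure_of[OF empirical_measure_def])
  let ?B = "restrict_space borel (unit_cube :: (real ^ 'n) set)"
  show "sets ?B \<subseteq> Pow unit_cube"
    using sets.space_closed[of ?B] by (simp add: space_restrict_space)
  show "A \<in> sets (empirical_measure N x)"
    using assms by simp
  show "positive (sets (empirical_measure N x))
     (\<lambda>A. (\<Sum>k=1..N. emeasure (return ?B (x k)) A) / of_nat N)"
    by (simp add: positive_def)
  show "countably_additive (sets (empirical_measure N x))
     (\<lambda>A. (\<Sum>k=1..N. emeasure (return ?B (x k)) A) / of_nat N)"
  proof (rule countably_additiveI)
    fix F :: "nat \<Rightarrow> (real ^ 'n) set"
    assume F: "range F \<subseteq> sets (empirical_measure N x)" "disjoint_family F"
    have "(\<Sum>i. (\<Sum>k=1..N. emeasure (return ?B (x k)) (F i)) / of_nat N)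
        = (\<Sum>i. \<Sum>k=1..N. emeasure (return ?B (x k)) (F i)) / of_nat N"
      by (simp add: divide_ennreal_def ennreal_suminf_multc)
    also have "(\<Sum>i. \<Sum>k=1..N. emeasure (return ?B (x k)) (F i))
        = (\<Sum>k=1..N. \<Sum>i. emeasure (return ?B (x k)) (F i))"
      by (rule suminf_sum) simp
    also have "\<dots> = (\<Sum>k=1..N. emeasure (return ?B (x k)) (\<Union>i. F i))"
      using F by (intro sum.cong refl suminf_emeasure) auto
    finally show "(\<Sum>i. (\<Sum>k=1..N. emeasure (return ?B (x k)) (F i)) / of_nat N) =
      (\<Sum>k=1..N. emeasure (return ?B (x k)) (\<Union>i. F i)) / of_nat N" .
  qed
qed

lemma prob_space_cube_measure: "prob_space (cube_measure :: (real ^ 'n) measure)"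
proof (rule prob_spaceI)
  have "emeasure (cube_measure :: (real ^ 'n) measure) (space cube_measure)
      = emeasure lborel (unit_cube :: (real ^ 'n) set)"
    by (simp add: cube_measure_def space_restrict_space emeasure_restrict_space)
  also have "\<dots> = 1"
  proof -
    have "(1 :: real ^ 'n) \<bullet> b = 1" "(0 :: real ^ 'n) \<bullet> b \<le> 1 \<bullet> b" if "b \<in> Basis" for b
      using that by (auto simp: Basis_vec_def inner_axis)
    then show ?thesis
      by (subst emeasure_lborel_cbox) (auto intro!: prod.neutral)
  qed
  finally show "emeasure (cube_measure :: (real ^ 'n) measure) (space cube_measure) = 1" .
qed

lemma prob_space_empirical_measure:
  fixes x :: "nat \<Rightarrow> real ^ 'n"
  assumes "N \<ge> 1" "\<forall>k\<in>{1..N}. x k \<in> unit_cube"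
  shows "prob_space (empirical_measure N x)"
proof (rule prob_spaceI)
  let ?B = "restrict_space borel (unit_cube :: (real ^ 'n) set)"
  have C: "unit_cube \<in> sets ?B"
    using sets.top[of ?B] by (simp add: space_restrict_space)
  have "emeasure (return ?B (x k)) unit_cube = 1" if "k \<in> {1..N}" for k
    using that assms C by (simp add: indicator_def)
  then show "emeasure (empirical_measure N x) (space (empirical_measure N x)) = 1"
    using assms(1) C
    by (simp add: emeasure_empirical_measure ennreal_of_nat_eq_real_of_nat divide_ennreal)
qed

lemma W_inf_cube_finite:
  fixes x :: "nat \<Rightarrow> real ^ 'n"
  assumes "N \<ge> 1" "\<forall>k\<in>{1..N}. x k \<in> unit_cube"
  shows "W_inf cube_measure (empirical_measure N x) < \<infinity>"
proof -
  let ?\<mu> = "cube_measure :: (real ^ 'n) measure"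
  let ?\<nu> = "empirical_measure N x"
  let ?\<pi> = "?\<mu> \<Otimes>\<^sub>M ?\<nu>"
  interpret \<mu>: prob_space ?\<mu> by (rule prob_space_cube_measure)
  interpret \<nu>: prob_space ?\<nu> by (rule prob_space_empirical_measure[OF assms])
  interpret P: pair_prob_space ?\<mu> ?\<nu> ..
  have "distr ?\<pi> ?\<mu> fst = ?\<mu>"
    by (rule \<nu>.distr_pair_fst)
  moreover have "distr ?\<pi> ?\<nu> snd = ?\<nu>"
  proof (rule measure_eqI)
    fix A assume "A \<in> sets (distr ?\<pi> ?\<nu> snd)"
    then have A: "A \<in> sets ?\<nu>" by simp
    then have "snd -` A \<inter> space ?\<pi> = space ?\<mu> \<times> A"
      using sets.sets_into_space[OF A] by (auto simp: space_pair_measure)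
    then show "emeasure (distr ?\<pi> ?\<nu> snd) A = emeasure ?\<nu> A"
      using \<nu>.emeasure_pair_measure_Times[OF sets.top A, of ?\<mu>] A \<mu>.emeasure_space_1
      by (subst emeasure_distr) (simp_all del: space_cube_measure)
  qed simp
  ultimately have mem: "?\<pi> \<in> couplings ?\<mu> ?\<nu>"
    by (simp add: couplings_def)
  obtain B where B: "\<And>y z :: real ^ 'n. y \<in> unit_cube \<Longrightarrow> z \<in> unit_cube \<Longrightarrow> norm (y - z) \<le> B"
    using bounded_cbox[of "0 :: real ^ 'n" 1] unfolding bounded_two_points dist_norm by blast
  have [measurable]: "(\<lambda>y. y) \<in> borel_measurable ?\<mu>" "(\<lambda>y. y) \<in> borel_measurable ?\<nu>"
    by (auto intro!: measurable_restrict_space1 simp: measurable_cong_sets[OF sets_cube_measure refl]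
        measurable_cong_sets[OF sets_empirical_measure refl])
  have [measurable]: "fst \<in> borel_measurable ?\<pi>" "snd \<in> borel_measurable ?\<pi>"
    using measurable_compose[OF measurable_fst, of "\<lambda>y. y" ?\<mu> borel ?\<nu>]
      measurable_compose[OF measurable_snd, of "\<lambda>y. y" ?\<nu> borel ?\<mu>] by simp_all
  have "(\<lambda>(y, z). ennreal (norm (y - z))) \<in> borel_measurable ?\<pi>"
    unfolding case_prod_beta by measurable
  then have "esssup ?\<pi> (\<lambda>(y, z). ennreal (norm (y - z))) \<le> ennreal B"
    by (rule esssup_I) (auto simp: space_pair_measure intro!: AE_I2 ennreal_leI B)
  then have "W_inf ?\<mu> ?\<nu> \<le> ennreal B"
    unfolding W_inf_def by (rule INF_lower2[OF mem])
  then show ?thesis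
    using le_less_trans[OF _ ennreal_less_top] by auto
qed

end

theory Submission
  imports Defs
begin

text \<open>
  Write \<open>M\<close> and \<open>A\<close> for the \<open>L\<^sup>\<infinity>\<close> and \<open>L\<^sup>1\<close> norms of the gradient, \<open>W\<close> for the Wasserstein
  distance and \<open>d\<close> for the dimension. The proof gives the error bound
  \<open>C * M powr ((d - 1) / d) * A powr (1 / d) * W\<close>. The cube is covered, up to a null set, by the
  \<open>N\<close> balls of radius \<open>W\<close> around the points \<open>x k\<close>, so \<open>N powr (1 / d) * W\<close> is bounded below by a
  constant, and multiplying by this factor turns the bound into the claimed one.

  Let \<open>\<pi>\<close> be a coupling that moves no mass further than \<open>r\<close>. The error is the integral of
  \<open>f y - f z\<close> against \<open>\<pi>\<close>. To estimate this increment, replace the values at \<open>y\<close> and \<open>z\<close> by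
  averages over two copies of the cube scaled down to diameter \<open>\<rho>\<close>, one containing \<open>y\<close>, the other
  its translate containing \<open>z\<close>. This costs \<open>2 * M * \<rho>\<close>. While the first copy slides
  along the segment to the second one, any given point lies in it for at most the fraction
  \<open>\<rho> / norm (z - y)\<close> of the time; hence the averages differ by at most a constant times
  \<open>\<rho> / \<rho> ^ d\<close> times the integral of the norm of the gradient over a ball of radius \<open>2 * r\<close> around
  \<open>y\<close> (\<open>integral_increment_le_gradient\<close>, \<open>increment_le_local_gradient\<close>). Since the first marginal
  of \<open>\<pi>\<close> is Lebesgue measure, integrating these local integrals over \<open>y\<close> gives at most the volume
  of the ball times \<open>A\<close>. With \<open>\<rho> = \<delta> * r\<close> the error is therefore of order
  \<open>r * (M * \<delta> + A * (\<delta> / \<delta> ^ d))\<close> (\<open>transport_bound_scale\<close>), and \<open>\<delta> = (A / M) powr (1 / d)\<close>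
  balances the two terms (\<open>optimise_scale\<close>).

  The gradient in the statement vanishes wherever \<open>f\<close> is not differentiable, so
  Rademacher's theorem is indispensable: nothing else connects this gradient with increments of \<open>f\<close>.
  On a line, Vitali coverings show that the set where the difference quotients oscillate is
  null (\<open>slope_osc_null\<close>). Tonelli's theorem then gives directional derivatives almost
  everywhere; they depend linearly on the direction because their integrals over boxes do; and
  linearity along countably many dense directions, together with the Lipschitz condition, is
  differentiability (\<open>rademacher\<close>). Increments are never recovered by integrating along individual
  lines. Instead a large step is divided into \<open>n\<close> equal ones before integrating over space
  (\<open>integral_increment_telescope\<close>), and \<open>n\<close> tends to infinity by dominated convergence.
\<close>

section \<open>Lipschitz functions of one real variable\<close>

text \<open>A point of \<open>S\<close> has arbitrarily short intervals ending at it that \<open>g\<close> stretches by a factor of at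
  most \<open>p\<close>. Vitali's theorem selects disjoint ones that cover almost all of \<open>S\<close> inside an open
  set barely larger than \<open>S\<close>; the remaining null set has a null image because \<open>g\<close> is Lipschitz.\<close>

lemma emeasure_image_le_of_small_slopes:
  fixes g :: "real \<Rightarrow> real"
  assumes mono: "strict_mono g" and lip: "L-lipschitz_on UNIV g"
    and S: "S \<in> sets borel" and gS: "g ` S \<in> sets borel" and p: "0 < p"
    and slope: "\<And>x d. x \<in> S \<Longrightarrow> d > 0 \<Longrightarrow> \<exists>h. h \<noteq> 0 \<and> \<bar>h\<bar> < d \<and> (g (x + h) - g x) / h < p"
  shows "emeasure lborel (g ` S) \<le> ennreal p * emeasure lborel S"
proof (cases "emeasure lborel S = \<infinity>")
  case True
  then show ?thesis using p by (simp add: ennreal_mult_top)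
next
  case fin: False
  show ?thesis
  proof (rule ennreal_le_epsilon)
    fix e :: real assume e: "0 < e"
    have "S \<in> sets lebesgue" "0 < e / p" using S e p by auto
    then obtain U where U: "open U" "S \<subseteq> U" and US: "emeasure lebesgue (U - S) < ennreal (e / p)"
      by (rule sets_lebesgue_outer_open)
    define I where "I = (\<lambda>i::real \<times> real. cball (fst i) (snd i))"
    define J where "J = (\<lambda>i::real \<times> real. {g (fst i - snd i)..g (fst i + snd i)})"
    define K where "K = {i. 0 < snd i \<and> I i \<subseteq> U \<and> g (fst i + snd i) - g (fst i - snd i) \<le> p * (2 * snd i)}"
    have cov: "\<exists>i. i \<in> K \<and> x \<in> cball (fst i) (snd i) \<and> snd i < d" if x: "x \<in> S" and d: "0 < d" for x d
    proof -
      have "x \<in> U" using x U by auto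
      then obtain d' where d': "d' > 0" "cball x d' \<subseteq> U"
        using U(1) unfolding open_contains_cball by blast
      obtain h where h: "h \<noteq> 0" "\<bar>h\<bar> < min d d'" "(g (x + h) - g x) / h < p"
        using slope[OF x, of "min d d'"] d d' by auto
      \<comment> \<open>centre and radius of the interval with endpoints \<open>x\<close> and
        \<open>x + h\<close>, whichever sign \<open>h\<close> has\<close>
      define i where "i = (x + h / 2, \<bar>h\<bar> / 2)"
      have "I i \<subseteq> cball x d'"
        using h by (auto simp: I_def i_def dist_real_def abs_if split: if_splits)
      moreover have "g (fst i + snd i) - g (fst i - snd i) \<le> p * (2 * snd i)"
      proof (cases "h > 0")
        case True
        then have eq: "fst i + snd i = x + h" "fst i - snd i = x" "2 * snd i = h"
          by (simp_all add: i_def)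
        show ?thesis unfolding eq using h True by (simp add: divide_simps mult.commute)
      next
        case False
        then have "h < 0" using h by simp
        then have eq: "fst i + snd i = x" "fst i - snd i = x + h" "2 * snd i = - h"
          by (simp_all add: i_def)
        show ?thesis unfolding eq using h \<open>h < 0\<close> by (simp add: divide_simps mult.commute)
      qed
      ultimately have "i \<in> K"
        using d' h by (auto simp: K_def i_def)
      moreover have "x \<in> cball (fst i) (snd i)" "snd i < d"
        using h by (auto simp: i_def dist_real_def)
      ultimately show ?thesis by blast
    qed
    have "0 < snd i" if "i \<in> K" for i
      using that by (simp add: K_def)
    from Vitali_covering_theorem_cballs[of K snd S fst, OF this cov] obtain C where C: "countable C" "C \<subseteq> K"
        and dis: "pairwise (\<lambda>i j. disjnt (cball (fst i) (snd i)) (cball (fst j) (snd j))) C"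
        and neg: "negligible (S - (\<Union>i\<in>C. cball (fst i) (snd i)))"
      by blast
    have disI: "disjoint_family_on I C"
      using dis by (auto simp: disjoint_family_on_def pairwise_def disjnt_def I_def)
    have disJ: "disjoint_family_on J C"
      unfolding disjoint_family_on_def
    proof (intro ballI impI)
      fix i j assume ij: "i \<in> C" "j \<in> C" "i \<noteq> j"
      have pos: "0 < snd i" "0 < snd j" using ij C by (auto simp: K_def)
      have "I i \<inter> I j = {}" using disI ij by (simp add: disjoint_family_on_def)
      then have "max (fst i - snd i) (fst j - snd j) \<notin> I i \<inter> I j" by simp
      then have "fst i + snd i < fst j - snd j \<or> fst j + snd j < fst i - snd i"
        using pos unfolding I_def cball_eq_atLeastAtMost Int_iff atLeastAtMost_iff by linarith
      then have "g (fst i + snd i) < g (fst j - snd j) \<or> g (fst j + snd j) < g (fst i - snd i)"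
        using strict_monoD[OF mono] by blast
      then show "J i \<inter> J j = {}"
        unfolding J_def by fastforce
    qed
    have JI: "emeasure lborel (J i) \<le> ennreal p * emeasure lborel (I i)" if "i \<in> C" for i
    proof -
      have i: "0 < snd i" "g (fst i + snd i) - g (fst i - snd i) \<le> p * (2 * snd i)"
        using that C by (auto simp: K_def)
      have "g (fst i - snd i) \<le> g (fst i + snd i)"
        using i mono by (simp add: strict_mono_less_eq)
      then have "emeasure lborel (J i) = ennreal (g (fst i + snd i) - g (fst i - snd i))"
        by (simp add: J_def)
      also have "\<dots> \<le> ennreal (p * (2 * snd i))" using i by (intro ennreal_leI) auto
      also have "\<dots> = ennreal p * emeasure lborel (I i)"
        using i p by (simp add: I_def cball_eq_atLeastAtMost ennreal_mult)
      finally show ?thesis .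
    qed
    have "emeasure lborel (\<Union>i\<in>C. J i) = (\<integral>\<^sup>+i. emeasure lborel (J i) \<partial>count_space C)"
      by (intro emeasure_UN_countable C disJ) (auto simp: J_def)
    also have "\<dots> \<le> (\<integral>\<^sup>+i. ennreal p * emeasure lborel (I i) \<partial>count_space C)"
      by (intro nn_integral_mono) (simp add: JI)
    also have "\<dots> = ennreal p * (\<integral>\<^sup>+i. emeasure lborel (I i) \<partial>count_space C)"
      by (rule nn_integral_cmult) simp
    also have "(\<integral>\<^sup>+i. emeasure lborel (I i) \<partial>count_space C) = emeasure lborel (\<Union>i\<in>C. I i)"
      by (intro emeasure_UN_countable[symmetric] C disI) (auto simp: I_def)
    also have "\<dots> \<le> emeasure lborel U"
      using C U by (intro emeasure_mono) (auto simp: K_def)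
    also have "emeasure lborel U = emeasure lborel (S \<union> (U - S))"
      using U by (simp add: Un_absorb1)
    also have "\<dots> \<le> emeasure lborel S + emeasure lborel (U - S)"
      using S U by (intro emeasure_subadditive) auto
    also have "emeasure lborel (U - S) \<le> ennreal (e / p)"
      using US S U by simp
    finally have main: "emeasure lborel (\<Union>i\<in>C. J i) \<le> ennreal p * (emeasure lborel S + ennreal (e / p))"
      by (simp add: mult_left_mono add_left_mono)
    let ?N = "S - (\<Union>i\<in>C. I i)"
    have "negligible (g ` ?N)"
    proof (rule negligible_locally_Lipschitz_image)
      show "negligible ?N" using neg by (simp add: I_def)
      show "\<exists>T B. open T \<and> x \<in> T \<and> (\<forall>y\<in>?N \<inter> T. norm (g y - g x) \<le> B * norm (y - x))" for x
        using lipschitz_onD[OF lip] by (intro exI[of _ UNIV] exI[of _ L]) (auto simp: dist_norm)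
    qed simp
    then have N0: "emeasure lebesgue (g ` ?N) = 0"
      by (simp add: negligible_iff_null_sets null_setsD1)
    have sub: "g ` S \<subseteq> g ` ?N \<union> (\<Union>i\<in>C. J i)"
    proof
      fix y assume "y \<in> g ` S"
      then obtain x where x: "x \<in> S" "y = g x" by auto
      show "y \<in> g ` ?N \<union> (\<Union>i\<in>C. J i)"
      proof (cases "x \<in> ?N")
        case False
        then obtain i where i: "i \<in> C" "x \<in> I i" using x by auto
        then have "y \<in> J i"
          using mono x by (auto simp: I_def J_def cball_eq_atLeastAtMost strict_mono_less_eq)
        then show ?thesis using i by auto
      qed (use x in auto)
    qed
    have borJ: "(\<Union>i\<in>C. J i) \<in> sets borel"
      using C by (intro sets.countable_UN') (auto simp: J_def)
    have sets: "g ` ?N \<in> sets lebesgue" "(\<Union>i\<in>C. J i) \<in> sets lebesgue"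
    proof -
      show "g ` ?N \<in> sets lebesgue" using \<open>negligible (g ` ?N)\<close> by (rule negligible_imp_sets)
      from borJ show "(\<Union>i\<in>C. J i) \<in> sets lebesgue" by simp
    qed
    have "emeasure lebesgue (g ` S) \<le> emeasure lebesgue (g ` ?N \<union> (\<Union>i\<in>C. J i))"
      by (rule emeasure_mono[OF sub sets.Un[OF sets]])
    also have "\<dots> \<le> emeasure lebesgue (g ` ?N) + emeasure lebesgue (\<Union>i\<in>C. J i)"
      by (rule emeasure_subadditive[OF sets])
    also have "\<dots> = emeasure lebesgue (\<Union>i\<in>C. J i)" by (simp add: N0)
    also have "\<dots> = emeasure lborel (\<Union>i\<in>C. J i)"
      using borJ by simp
    finally have "emeasure lborel (g ` S) \<le> emeasure lborel (\<Union>i\<in>C. J i)"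
      using gS by simp
    also note main
    also have "ennreal p * (emeasure lborel S + ennreal (e / p)) = ennreal p * emeasure lborel S + ennreal e"
      using p e by (simp add: distrib_left ennreal_mult[symmetric])
    finally show "emeasure lborel (g ` S) \<le> ennreal p * emeasure lborel S + ennreal e" .
  qed
qed

text \<open>The points at which the lower derivative of \<open>g\<close> is less than \<open>p\<close> and the upper one is greater
  than \<open>q\<close>, up to the boundary cases of equality. Bounding the increments \<open>h\<close> by the countably
  many values \<open>1 / Suc n\<close> makes this a countable intersection of open sets when \<open>g\<close> is continuous.\<close>

definition slope_osc :: "real \<Rightarrow> real \<Rightarrow> (real \<Rightarrow> real) \<Rightarrow> real set"
  where "slope_osc p q g = {x. \<forall>n::nat.
    (\<exists>h. h \<noteq> 0 \<and> \<bar>h\<bar> < 1 / Suc n \<and> (g (x + h) - g x) / h < p) \<and>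
    (\<exists>h. h \<noteq> 0 \<and> \<bar>h\<bar> < 1 / Suc n \<and> q < (g (x + h) - g x) / h)}"

lemma slope_osc_borel:
  assumes g: "continuous_on UNIV g"
  shows "slope_osc p q g \<in> sets borel"
proof -
  have cont: "continuous_on UNIV (\<lambda>x. (g (x + h) - g x) / h)" if "h \<noteq> 0" for h
    using that by (intro continuous_intros continuous_on_compose2[OF g]) auto
  have "open {x. \<exists>h. h \<noteq> 0 \<and> \<bar>h\<bar> < e \<and> (g (x + h) - g x) / h < p}" for e
  proof -
    have "{x. \<exists>h. h \<noteq> 0 \<and> \<bar>h\<bar> < e \<and> (g (x + h) - g x) / h < p}
      = (\<Union>h\<in>{h. h \<noteq> 0 \<and> \<bar>h\<bar> < e}. {x. (g (x + h) - g x) / h < p})" by auto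
    also have "open \<dots>"
      using cont by (intro open_UN ballI open_Collect_less continuous_on_const) auto
    finally show ?thesis .
  qed
  moreover have "open {x. \<exists>h. h \<noteq> 0 \<and> \<bar>h\<bar> < e \<and> q < (g (x + h) - g x) / h}" for e
  proof -
    have "{x. \<exists>h. h \<noteq> 0 \<and> \<bar>h\<bar> < e \<and> q < (g (x + h) - g x) / h}
      = (\<Union>h\<in>{h. h \<noteq> 0 \<and> \<bar>h\<bar> < e}. {x. q < (g (x + h) - g x) / h})" by auto
    also have "open \<dots>"
      using cont by (intro open_UN ballI open_Collect_less continuous_on_const) auto
    finally show ?thesis .
  qed
  moreover have "slope_osc p q g = (\<Inter>n::nat.
      {x. \<exists>h. h \<noteq> 0 \<and> \<bar>h\<bar> < 1 / Suc n \<and> (g (x + h) - g x) / h < p} \<inter>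
      {x. \<exists>h. h \<noteq> 0 \<and> \<bar>h\<bar> < 1 / Suc n \<and> q < (g (x + h) - g x) / h})"
    by (auto simp: slope_osc_def)
  ultimately show ?thesis
    by (auto intro!: sets.countable_INT sets.Int)
qed

text \<open>The covering estimate applies twice. The slopes below \<open>p\<close> show that \<open>g\<close> maps \<open>S\<close> to a set of
  measure at most \<open>p\<close> times that of \<open>S\<close>; the slopes above \<open>q\<close> are slopes below \<open>1 / q\<close> of the
  inverse function, so the measure of \<open>S\<close> is at most \<open>1 / q\<close> times that of the image. As
  \<open>p < q\<close>, a set of finite measure can satisfy both only if it is null.\<close>

lemma slope_osc_null:
  fixes g :: "real \<Rightarrow> real"
  assumes lip: "L-lipschitz_on UNIV g" and steep: "\<And>x y. x \<le> y \<Longrightarrow> y - x \<le> g y - g x"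
    and pq: "0 < p" "p < q"
  shows "slope_osc p q g \<in> null_sets lborel"
proof -
  have cont: "continuous_on UNIV g" using lip by (rule lipschitz_on_continuous_on)
  have mono: "strict_mono g"
  proof
    fix x y :: real assume "x < y" then show "g x < g y" using steep[of x y] by simp
  qed
  have "surj g"
    unfolding surj_def
  proof
    fix y
    define a where "a = \<bar>y - g 0\<bar>"
    have "g (- a) \<le> y" "y \<le> g a"
      using steep[of "-a" 0] steep[of 0 a] by (auto simp: a_def)
    then show "\<exists>x. y = g x"
      using IVT'[of g "-a" y a] continuous_on_subset[OF cont, of "{-a..a}"] by (force simp: a_def)
  qed
  define k where "k = inv g"
  have gk: "g (k y) = y" for y by (simp add: k_def \<open>surj g\<close> surj_f_inv_f)
  have kg: "k (g x) = x" for x by (simp add: k_def strict_mono_imp_inj_on[OF mono])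
  have kmono: "strict_mono k"
  proof
    fix x y :: real assume "x < y" 
    then have "g (k x) < g (k y)" by (simp add: gk)
    then show "k x < k y" by (simp add: strict_mono_less[OF mono])
  qed
  have kle: "\<bar>k x - k y\<bar> \<le> \<bar>x - y\<bar>" for x y
    using steep[of "k x" "k y"] steep[of "k y" "k x"] by (cases "k x \<le> k y") (auto simp: gk)
  have klip: "1-lipschitz_on UNIV k"
    by (rule lipschitz_onI) (use kle in \<open>auto simp: dist_real_def\<close>)
  have kcont: "continuous_on UNIV k" using klip by (rule lipschitz_on_continuous_on)
  have L: "0 \<le> L" using lip by (rule lipschitz_on_nonneg)
  have "slope_osc p q g \<inter> {- real m..real m} \<in> null_sets lborel" for m :: nat
  proof -
    define S where "S = slope_osc p q g \<inter> {- real m..real m}"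
    have S: "S \<in> sets borel" unfolding S_def by (intro sets.Int slope_osc_borel[OF cont] atLeastAtMost_borel)
    have gS: "g ` S = k -` S"
    proof (intro equalityI subsetI)
      fix y assume "y \<in> k -` S"
      then show "y \<in> g ` S" using gk[of y] by (intro image_eqI[of _ _ "k y"]) simp_all
    qed (auto simp: kg)
    have gSb: "g ` S \<in> sets borel" 
      unfolding gS using measurable_sets[OF borel_measurable_continuous_onI[OF kcont] S] by simp
    have kgS: "k ` (g ` S) = S" by (auto simp: kg image_image)
    have small: "\<exists>n::nat. 1 / Suc n < d" if "d > 0" for d :: real
      using nat_approx_posE[OF that] by metis
    have 1: "emeasure lborel (g ` S) \<le> ennreal p * emeasure lborel S"
    proof (rule emeasure_image_le_of_small_slopes[OF mono lip S gSb pq(1)])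
      fix x d :: real assume "x \<in> S" "d > 0"
      obtain n :: nat where "1 / Suc n < d" using small \<open>d > 0\<close> by blast
      moreover obtain h where "h \<noteq> 0" "\<bar>h\<bar> < 1 / Suc n" "(g (x + h) - g x) / h < p"
        using \<open>x \<in> S\<close> unfolding S_def slope_osc_def by blast
      ultimately show "\<exists>h. h \<noteq> 0 \<and> \<bar>h\<bar> < d \<and> (g (x + h) - g x) / h < p" 
        by (intro exI[of _ h]) linarith
    qed
    have 2: "emeasure lborel (k ` (g ` S)) \<le> ennreal (1 / q) * emeasure lborel (g ` S)"
    proof (rule emeasure_image_le_of_small_slopes[OF kmono klip gSb])
      show "k ` (g ` S) \<in> sets borel" using S by (simp only: kgS)
      show "0 < 1 / q" using pq by simp
      fix y d :: real assume "y \<in> g ` S" "d > 0"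
      then obtain x where x: "x \<in> S" "y = g x" by auto
      have "0 < d / (L + 1)" using \<open>d > 0\<close> L by simp
      then obtain n :: nat where n: "1 / Suc n < d / (L + 1)" using small by blast
      obtain h where h: "h \<noteq> 0" "\<bar>h\<bar> < 1 / Suc n" "q < (g (x + h) - g x) / h"
        using \<open>x \<in> S\<close> unfolding S_def slope_osc_def by blast
      define h' where "h' = g (x + h) - g x"
      have "\<bar>h'\<bar> \<le> L * \<bar>h\<bar>"
        using lipschitz_onD[OF lip, of "x + h" x] by (simp add: h'_def dist_real_def)
      also have "\<dots> \<le> (L + 1) * \<bar>h\<bar>" by (simp add: mult_right_mono)
      also have "\<dots> < (L + 1) * (d / (L + 1))"
        using n h L by (intro mult_strict_left_mono) auto
      also have "\<dots> = d" using L by simp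
      finally have "\<bar>h'\<bar> < d" .
      moreover have pos: "0 < h' / h" using h pq by (simp add: h'_def)
      then have "h' \<noteq> 0" by auto
      moreover have "(k (y + h') - k y) / h' = 1 / (h' / h)"
        by (simp add: x h'_def kg)
      moreover have "1 / (h' / h) < 1 / q"
      proof (rule divide_strict_left_mono)
        show "q < h' / h" using h by (simp add: h'_def)
        show "0 < h' / h * q" using pos pq by (intro mult_pos_pos) auto
      qed simp
      ultimately show "\<exists>h. h \<noteq> 0 \<and> \<bar>h\<bar> < d \<and> (k (y + h) - k y) / h < 1 / q"
        by (intro exI[of _ h']) simp
    qed
    have "emeasure lborel S \<le> emeasure lborel {- real m..real m}"
      by (rule emeasure_mono) (auto simp: S_def)
    then have "emeasure lborel S < \<infinity>"
      by (simp add: le_less_trans[OF _ ennreal_less_top])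
    then obtain s where s: "emeasure lborel S = ennreal s" "0 \<le> s"
      by (cases "emeasure lborel S") auto
    have "ennreal s \<le> ennreal (1 / q) * (ennreal p * ennreal s)"
      using order_trans[OF 2 mult_left_mono[OF 1]] unfolding kgS s by simp
    also have "\<dots> = ennreal (p / q * s)"
      using pq s by (simp add: ennreal_mult[symmetric])
    finally have "s \<le> p / q * s" using pq s by (simp add: ennreal_le_iff)
    then have "s * q \<le> s * p" using pq by (simp add: field_simps)
    then have "s = 0" using pq s by (simp add: mult_le_cancel_left)
    then show ?thesis using S s unfolding S_def by (intro null_setsI) auto
  qed
  then have "(\<Union>m::nat. slope_osc p q g \<inter> {- real m..real m}) \<in> null_sets lborel"
    by (intro null_sets_UN)
  moreover have "(\<Union>m::nat. slope_osc p q g \<inter> {- real m..real m}) = slope_osc p q g"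
  proof -
    have "\<exists>m::nat. - real m \<le> x \<and> x \<le> real m" for x
    proof -
      obtain m :: nat where "\<bar>x\<bar> \<le> real m" using real_arch_simple by blast
      then have "- real m \<le> x \<and> x \<le> real m" by linarith
      then show ?thesis by blast
    qed
    then show ?thesis by auto
  qed
  ultimately show ?thesis by simp
qed

lemma tendsto_at_0_if_no_oscillation:
  fixes \<phi> :: "real \<Rightarrow> real"
  assumes bnd: "\<And>h. h \<noteq> 0 \<Longrightarrow> \<bar>\<phi> h\<bar> \<le> B"
    and no: "\<And>p q. p \<in> \<rat> \<Longrightarrow> q \<in> \<rat> \<Longrightarrow> p < q \<Longrightarrow>
      \<not> ((\<exists>\<^sub>F h in at 0. \<phi> h < p) \<and> (\<exists>\<^sub>F h in at 0. q < \<phi> h))"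
  shows "\<exists>l. (\<phi> \<longlongrightarrow> l) (at 0)"
proof -
  let ?e = "\<lambda>h. ereal (\<phi> h)"
  let ?l = "Liminf (at 0) ?e" and ?u = "Limsup (at 0) ?e"
  have ev: "\<forall>\<^sub>F h in at 0. \<bar>\<phi> h\<bar> \<le> B"
    using bnd by (auto simp: eventually_at intro!: exI[of _ 1])
  have "?l \<le> ?u" by (rule Liminf_le_Limsup) simp
  moreover have "\<not> ?l < ?u"
  proof
    assume "?l < ?u"
    then obtain c where c: "?l < ereal c" "ereal c < ?u" using ereal_dense2 by blast
    obtain p where p: "?l < ereal (of_rat p)" "ereal (of_rat p) < ereal c"
      using ereal_dense3[OF c(1)] by blast
    obtain q where q: "ereal c < ereal (of_rat q)" "ereal (of_rat q) < ?u"
      using ereal_dense3[OF c(2)] by blast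
    have "\<exists>\<^sub>F h in at 0. \<phi> h < of_rat p"
    proof (rule ccontr)
      assume "\<not> ?thesis"
      then have "\<forall>\<^sub>F h in at 0. ereal (of_rat p) \<le> ?e h"
        by (simp add: frequently_def not_less)
      then have "ereal (of_rat p) \<le> ?l" by (rule Liminf_bounded)
      with p show False by simp
    qed
    moreover have "\<exists>\<^sub>F h in at 0. of_rat q < \<phi> h"
    proof (rule ccontr)
      assume "\<not> ?thesis"
      then have "\<forall>\<^sub>F h in at 0. ?e h \<le> ereal (of_rat q)"
        by (simp add: frequently_def not_less)
      then have "?u \<le> ereal (of_rat q)" by (rule Limsup_bounded)
      with q show False by simp
    qed
    ultimately show False using no[of "of_rat p" "of_rat q"] p q by auto
  qed
  ultimately have eq: "?u = ?l" by simp
  have "ereal (- B) \<le> ?l"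
    by (rule Liminf_bounded) (use ev in \<open>auto elim!: eventually_mono\<close>)
  moreover have "?u \<le> ereal B"
    by (rule Limsup_bounded) (use ev in \<open>auto elim!: eventually_mono\<close>)
  ultimately obtain r where r: "?l = ereal r"
    using eq by (cases ?l) auto
  have "(?e \<longlongrightarrow> ?l) (at 0)"
    by (rule tendsto_Liminf) (simp_all add: eq)
  then show ?thesis unfolding r by auto
qed

text \<open>Adding a steep linear function makes \<open>g\<close> increase with slope at least \<open>1\<close> without changing where
  its difference quotients converge.\<close>

theorem lipschitz_real_AE_differentiable:
  fixes g :: "real \<Rightarrow> real"
  assumes lip: "L-lipschitz_on UNIV g"
  shows "AE t in lborel. \<exists>l. ((\<lambda>h. (g (t + h) - g t) / h) \<longlongrightarrow> l) (at 0)"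
proof -
  define G where "G x = g x + (L + 1) * x" for x
  have L: "0 \<le> L" using lip by (rule lipschitz_on_nonneg)
  have gL: "\<bar>g x - g y\<bar> \<le> L * \<bar>x - y\<bar>" for x y
    using lipschitz_onD[OF lip, of x y] by (simp add: dist_real_def)
  have Glip: "(L + (L + 1))-lipschitz_on UNIV G"
    unfolding G_def using L by (intro lipschitz_on_add lip lipschitz_onI) 
      (auto simp: dist_real_def abs_mult simp flip: right_diff_distrib)
  have steep: "y - x \<le> G y - G x" if "x \<le> y" for x y
    using gL[of x y] that by (auto simp: G_def algebra_simps)
  have quot: "(G (t + h) - G t) / h = (g (t + h) - g t) / h + (L + 1)" if "h \<noteq> 0" for t h
    using that by (simp add: G_def field_simps)
  \<comment> \<open>no slope of \<open>G\<close> is negative, so the set is empty when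
    \<open>p\<close> is not positive\<close>
  have null: "slope_osc p q G \<in> null_sets lborel" if "p < q" for p q
  proof (cases "p > 0")
    case True
    then show ?thesis using slope_osc_null[OF Glip steep] that by blast
  next
    case False
    have "0 \<le> (G (t + h) - G t) / h" if "h \<noteq> 0" for t h
    proof (cases "h > 0")
      case True
      then show ?thesis using steep[of t "t + h"] by simp
    next
      case False
      then have "h < 0" using that by simp
      then show ?thesis using steep[of "t + h" t] by (intro divide_nonpos_nonpos) auto
    qed
    then have "\<not> (G (t + h) - G t) / h < p" if "h \<noteq> 0" for t h
      using False that by (meson not_less order_trans)
    then have "slope_osc p q G = {}"
      unfolding slope_osc_def by blast
    then show ?thesis by simp
  qed
  have "AE t in lborel. \<forall>p\<in>\<rat>. \<forall>q\<in>\<rat>. p < q \<longrightarrow> t \<notin> slope_osc p q G"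
    using null by (intro AE_ball_countable[THEN iffD2] ballI countable_rat)
      (auto intro: AE_not_in)
  then show ?thesis
  proof (rule AE_mp, intro AE_I2 impI)
    fix t assume t: "\<forall>p\<in>\<rat>. \<forall>q\<in>\<rat>. p < q \<longrightarrow> t \<notin> slope_osc p q G"
    have "\<exists>l. ((\<lambda>h. (G (t + h) - G t) / h) \<longlongrightarrow> l) (at 0)"
    proof (rule tendsto_at_0_if_no_oscillation)
      fix h :: real assume "h \<noteq> 0"
      then show "\<bar>(G (t + h) - G t) / h\<bar> \<le> L + (L + 1)"
        using lipschitz_onD[OF Glip, of "t + h" t] by (simp add: dist_real_def divide_simps)
    next
      fix p q :: real assume pq: "p \<in> \<rat>" "q \<in> \<rat>" "p < q"
      have *: "\<exists>h. h \<noteq> 0 \<and> \<bar>h\<bar> < 1 / Suc n \<and> P h" if "\<exists>\<^sub>F h in at 0. P h" for P and n :: nat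
        using that unfolding frequently_at by (auto simp: dist_real_def)
      show "\<not> ((\<exists>\<^sub>F h in at 0. (G (t + h) - G t) / h < p) \<and> (\<exists>\<^sub>F h in at 0. q < (G (t + h) - G t) / h))"
        using t pq * unfolding slope_osc_def by blast
    qed
    then obtain l where l: "((\<lambda>h. (G (t + h) - G t) / h) \<longlongrightarrow> l) (at 0)" ..
    have "((\<lambda>h. (G (t + h) - G t) / h - (L + 1)) \<longlongrightarrow> l - (L + 1)) (at 0)"
      by (intro tendsto_intros l)
    also have "?this \<longleftrightarrow> ((\<lambda>h. (g (t + h) - g t) / h) \<longlongrightarrow> l - (L + 1)) (at 0)"
      by (intro tendsto_cong) (auto simp: eventually_at quot intro!: exI[of _ 1])
    finally show "\<exists>l. ((\<lambda>h. (g (t + h) - g t) / h) \<longlongrightarrow> l) (at 0)" ..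
  qed
qed

section \<open>Directional derivatives of Lipschitz functions\<close>

definition diff_quot :: "('a::euclidean_space \<Rightarrow> real) \<Rightarrow> 'a \<Rightarrow> nat \<Rightarrow> 'a \<Rightarrow> real"
  where "diff_quot f v n x = (f (x + (1 / real (Suc n)) *\<^sub>R v) - f x) * real (Suc n)"

text \<open>The limit along a sequence is a Borel function without any exceptional set. It is the
  two-sided directional derivative at almost every point.\<close>

definition dir_deriv :: "('a::euclidean_space \<Rightarrow> real) \<Rightarrow> 'a \<Rightarrow> 'a \<Rightarrow> real"
  where "dir_deriv f v x = lim (\<lambda>n. diff_quot f v n x)"

lemma inverse_Suc_tendsto_at_0: "filterlim (\<lambda>n. 1 / real (Suc n)) (at 0) sequentially"
  unfolding filterlim_at
proof
  show "\<forall>\<^sub>F n in sequentially. 1 / real (Suc n) \<in> UNIV \<and> 1 / real (Suc n) \<noteq> 0" by simp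
  show "(\<lambda>n. 1 / real (Suc n)) \<longlonglongrightarrow> 0"
    using LIMSEQ_inverse_real_of_nat by (simp add: inverse_eq_divide)
qed

locale lipschitz_function =
  fixes f :: "'a::euclidean_space \<Rightarrow> real" and L :: real
  assumes lip: "L-lipschitz_on UNIV f"
begin

lemma continuous_f: "continuous_on S f"
  using lipschitz_on_continuous_on[OF lip] continuous_on_subset by blast

lemma borel_f [measurable]: "f \<in> borel_measurable borel"
  by (rule borel_measurable_continuous_onI[OF continuous_f])

lemma L_nonneg: "0 \<le> L"
  using lip by (rule lipschitz_on_nonneg)

lemma lip_norm: "\<bar>f x - f y\<bar> \<le> L * norm (x - y)"
  using lipschitz_onD[OF lip, of x y] by (simp add: dist_norm)

lemma diff_quot_bound: "\<bar>diff_quot f v n x\<bar> \<le> L * norm v"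
proof -
  have "\<bar>f (x + (1 / real (Suc n)) *\<^sub>R v) - f x\<bar> \<le> L * (norm v / Suc n)"
    using lip_norm[of "x + (1 / real (Suc n)) *\<^sub>R v" x] by simp
  then have "\<bar>diff_quot f v n x\<bar> \<le> L * (norm v / Suc n) * Suc n"
    unfolding diff_quot_def abs_mult by (intro mult_mono) (auto simp: L_nonneg)
  then show ?thesis by (simp del: of_nat_Suc)
qed

lemma borel_diff_quot [measurable]: "diff_quot f v n \<in> borel_measurable borel"
  unfolding diff_quot_def by measurable

lemma borel_dir_deriv [measurable]: "dir_deriv f v \<in> borel_measurable borel"
  unfolding dir_deriv_def by (intro borel_measurable_lim_metric) measurable

text \<open>The Cauchy condition describes the points of differentiability by closed conditions and countable
  quantifiers only, hence by a Borel set.\<close>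

lemma directional_limit_iff_Cauchy:
  "(\<exists>l. ((\<lambda>h. (f (x + h *\<^sub>R v) - f x) / h) \<longlongrightarrow> l) (at 0)) \<longleftrightarrow>
   (\<forall>k::nat. \<exists>m::nat. \<forall>s t. s \<noteq> 0 \<and> t \<noteq> 0 \<and> \<bar>s\<bar> < 1 / Suc m \<and> \<bar>t\<bar> < 1 / Suc m \<longrightarrow>
      \<bar>(f (x + s *\<^sub>R v) - f x) / s - (f (x + t *\<^sub>R v) - f x) / t\<bar> \<le> 1 / Suc k)"
    (is "?lhs \<longleftrightarrow> ?rhs")
proof
  let ?q = "\<lambda>h. (f (x + h *\<^sub>R v) - f x) / h"
  assume ?lhs
  then obtain l where l: "(?q \<longlongrightarrow> l) (at 0)" ..
  show ?rhs
  proof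
    fix k :: nat
    have "0 < 1 / (2 * real (Suc k))" by simp
    then have "\<forall>\<^sub>F h in at 0. dist (?q h) l < 1 / (2 * real (Suc k))"
      using l tendstoD by blast
    then obtain d where d: "d > 0" "\<And>h. h \<noteq> 0 \<Longrightarrow> \<bar>h\<bar> < d \<Longrightarrow> \<bar>?q h - l\<bar> < 1 / (2 * real (Suc k))"
      unfolding eventually_at by (auto simp: dist_real_def)
    obtain m :: nat where m: "1 / Suc m < d" using nat_approx_posE[OF d(1)] by metis
    have "\<bar>?q s - ?q t\<bar> \<le> 1 / Suc k" if "s \<noteq> 0 \<and> t \<noteq> 0 \<and> \<bar>s\<bar> < 1 / Suc m \<and> \<bar>t\<bar> < 1 / Suc m" for s t
    proof -
      have "\<bar>?q s - l\<bar> < 1 / (2 * real (Suc k))" "\<bar>?q t - l\<bar> < 1 / (2 * real (Suc k))"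
        using that m d(2)[of s] d(2)[of t] by linarith+
      then have "\<bar>?q s - ?q t\<bar> \<le> 1 / (2 * real (Suc k)) + 1 / (2 * real (Suc k))" by linarith
      also have "\<dots> = 1 / Suc k" by (simp add: field_simps)
      finally show ?thesis .
    qed
    then show "\<exists>m::nat. \<forall>s t. s \<noteq> 0 \<and> t \<noteq> 0 \<and> \<bar>s\<bar> < 1 / Suc m \<and> \<bar>t\<bar> < 1 / Suc m \<longrightarrow>
      \<bar>?q s - ?q t\<bar> \<le> 1 / Suc k" by blast
  qed
next
  let ?q = "\<lambda>h. (f (x + h *\<^sub>R v) - f x) / h"
  assume r: ?rhs
  have key: "\<exists>m::nat. \<forall>s t. s \<noteq> 0 \<and> t \<noteq> 0 \<and> \<bar>s\<bar> < 1 / Suc m \<and> \<bar>t\<bar> < 1 / Suc m \<longrightarrow> \<bar>?q s - ?q t\<bar> < e"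
    if "e > 0" for e
  proof -
    obtain k :: nat where k: "1 / Suc k < e" using nat_approx_posE[OF \<open>e > 0\<close>] by metis
    then show ?thesis using r[rule_format, of k] by (meson le_less_trans)
  qed
  let ?s = "\<lambda>n::nat. ?q (1 / Suc (Suc n))"
  have mono: "1 / Suc (Suc n) < 1 / Suc m" if "n \<ge> m" for n m :: nat
    using that by (intro divide_strict_left_mono) auto
  have "Cauchy ?s"
  proof (rule metric_CauchyI)
    fix e :: real assume "e > 0"
    obtain m :: nat where m: "\<forall>s t. s \<noteq> 0 \<and> t \<noteq> 0 \<and> \<bar>s\<bar> < 1 / Suc m \<and> \<bar>t\<bar> < 1 / Suc m \<longrightarrow> \<bar>?q s - ?q t\<bar> < e"
      using key[OF \<open>e > 0\<close>] by blast
    have "dist (?s i) (?s j) < e" if "i \<ge> m" "j \<ge> m" for i j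
      unfolding dist_real_def using mono[OF that(1)] mono[OF that(2)]
      by (intro m[rule_format]) (simp del: of_nat_Suc)
    then show "\<exists>M. \<forall>m\<ge>M. \<forall>n\<ge>M. dist (?s m) (?s n) < e" by blast
  qed
  then obtain l where l: "?s \<longlonglongrightarrow> l" using Cauchy_convergent convergent_def by blast
  have "(?q \<longlongrightarrow> l) (at 0)"
  proof (rule tendstoI)
    fix e :: real assume "e > 0"
    then obtain m :: nat where m: "\<forall>s t. s \<noteq> 0 \<and> t \<noteq> 0 \<and> \<bar>s\<bar> < 1 / Suc m \<and> \<bar>t\<bar> < 1 / Suc m \<longrightarrow> \<bar>?q s - ?q t\<bar> < e/2"
      using key[of "e/2"] by auto
    have "dist (?q h) l < e" if "h \<noteq> 0" "\<bar>h\<bar> < 1 / Suc m" for h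
    proof -
      have "(\<lambda>n. \<bar>?q h - ?s n\<bar>) \<longlonglongrightarrow> \<bar>?q h - l\<bar>" by (intro tendsto_intros l)
      moreover have "\<forall>\<^sub>F n in sequentially. \<bar>?q h - ?s n\<bar> \<le> e/2"
        using eventually_ge_at_top[of m]
      proof eventually_elim
        case (elim n)
        then show ?case using that mono[OF elim]
          by (intro less_imp_le m[rule_format]) (simp del: of_nat_Suc)
      qed
      ultimately have "\<bar>?q h - l\<bar> \<le> e / 2"
        by (intro tendsto_upperbound) auto
      then show ?thesis using \<open>e > 0\<close> by (simp add: dist_real_def)
    qed
    then show "\<forall>\<^sub>F h in at 0. dist (?q h) l < e"
      unfolding eventually_at by (intro exI[of _ "1 / Suc m"]) (auto simp: dist_real_def)
  qed
  then show ?lhs ..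
qed

text \<open>On each line of direction \<open>v\<close> the exceptional set is null by the one-dimensional theorem. Rather
  than rotating \<open>v\<close> into a coordinate axis, integrate the indicator of the exceptional set at
  \<open>x + t *\<^sub>R v\<close> over \<open>x\<close> and all real \<open>t\<close>: integrating over \<open>t\<close> first gives \<open>0\<close>, while integrating over
  \<open>x\<close> first gives infinitely many times the measure of the set.\<close>

lemma AE_directional_limit_exists:
  "AE x in lborel. \<exists>l. ((\<lambda>h. (f (x + h *\<^sub>R v) - f x) / h) \<longlongrightarrow> l) (at 0)"
proof -
  define E where "E = {x. \<exists>l. ((\<lambda>h. (f (x + h *\<^sub>R v) - f x) / h) \<longlongrightarrow> l) (at 0)}"
  have cl: "closed {x. \<bar>(f (x + s *\<^sub>R v) - f x) / s - (f (x + t *\<^sub>R v) - f x) / t\<bar> \<le> c}" for s t c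
  proof (rule closed_Collect_le)
    show "continuous_on UNIV (\<lambda>x. \<bar>(f (x + s *\<^sub>R v) - f x) / s - (f (x + t *\<^sub>R v) - f x) / t\<bar>)"
      unfolding divide_inverse by (intro continuous_intros continuous_on_compose2[OF continuous_f[of UNIV]]) auto
  qed simp
  have "E = (\<Inter>k::nat. \<Union>m::nat. \<Inter>(s,t)\<in>{(s,t). s \<noteq> 0 \<and> t \<noteq> 0 \<and> \<bar>s\<bar> < 1 / Suc m \<and> \<bar>t\<bar> < 1 / Suc m}.
     {x. \<bar>(f (x + s *\<^sub>R v) - f x) / s - (f (x + t *\<^sub>R v) - f x) / t\<bar> \<le> 1 / Suc k})"
    unfolding E_def directional_limit_iff_Cauchy by auto
  also have "\<dots> \<in> sets borel"
    by (intro sets.countable_INT'' sets.countable_UN'' borel_closed closed_INT ballI) (auto intro!: cl)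
  finally have E [measurable]: "E \<in> sets borel" .
  have "emeasure lborel (- E) * \<infinity> = (\<integral>\<^sup>+t. emeasure lborel (- E) \<partial>(lborel :: real measure))"
    by (simp add: mult.commute)
  also have "\<dots> = (\<integral>\<^sup>+t. (\<integral>\<^sup>+x. indicator (- E) (x + t *\<^sub>R v) \<partial>lborel) \<partial>lborel)"
  proof (rule nn_integral_cong)
    fix t :: real
    have "emeasure lborel (- E) = (\<integral>\<^sup>+x. indicator (- E) x \<partial>distr lborel borel ((+) (t *\<^sub>R v)))"
      unfolding lborel_distr_plus by simp
    also have "\<dots> = (\<integral>\<^sup>+x. indicator (- E) (t *\<^sub>R v + x) \<partial>lborel)"
      by (subst nn_integral_distr) auto
    finally show "emeasure lborel (- E) = (\<integral>\<^sup>+x. indicator (- E) (x + t *\<^sub>R v) \<partial>lborel)"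
      by (simp add: add.commute)
  qed
  also have "\<dots> = (\<integral>\<^sup>+x. (\<integral>\<^sup>+t. indicator (- E) (x + t *\<^sub>R v) \<partial>lborel) \<partial>lborel)"
    by (rule lborel_pair.Fubini'[symmetric]) measurable
  also have "\<dots> = (\<integral>\<^sup>+x. 0 \<partial>(lborel :: 'a measure))"
  proof (rule nn_integral_cong)
    fix x :: 'a
    have "(L * norm v)-lipschitz_on UNIV (\<lambda>t. f (x + t *\<^sub>R v))"
    proof (rule lipschitz_onI)
      fix s t :: real
      show "dist (f (x + s *\<^sub>R v)) (f (x + t *\<^sub>R v)) \<le> L * norm v * dist s t"
        using lip_norm[of "x + s *\<^sub>R v" "x + t *\<^sub>R v"] 
        by (simp add: dist_real_def mult_ac flip: scaleR_left_diff_distrib)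
    qed (simp add: L_nonneg)
    from lipschitz_real_AE_differentiable[OF this]
    have "AE t in lborel. x + t *\<^sub>R v \<in> E"
      by (rule AE_mp) (auto simp: E_def algebra_simps intro!: AE_I2)
    then have "AE t in lborel. indicator (- E) (x + t *\<^sub>R v) = (0::ennreal)"
      by (rule AE_mp) (auto intro!: AE_I2)
    then show "(\<integral>\<^sup>+t. indicator (- E) (x + t *\<^sub>R v) \<partial>lborel) = 0"
      by (subst nn_integral_0_iff_AE) auto
  qed
  also have "\<dots> = 0" by simp
  finally have "emeasure lborel (- E) = 0" by (auto simp: ennreal_mult_eq_top_iff ennreal_mult_top split: if_splits)
  then have "- E \<in> null_sets lborel" by (intro null_setsI) auto
  then show ?thesis
    by (rule AE_I') (auto simp: E_def)
qed

lemma AE_dir_deriv: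
  "AE x in lborel. ((\<lambda>h. (f (x + h *\<^sub>R v) - f x) / h) \<longlongrightarrow> dir_deriv f v x) (at 0)"
  using AE_directional_limit_exists[of v]
proof eventually_elim
  case (elim x)
  then obtain l where l: "((\<lambda>h. (f (x + h *\<^sub>R v) - f x) / h) \<longlongrightarrow> l) (at 0)" ..
  have "(\<lambda>n. diff_quot f v n x) \<longlonglongrightarrow> l"
    using filterlim_compose[OF l inverse_Suc_tendsto_at_0] by (simp add: diff_quot_def del: of_nat_Suc)
  then have "dir_deriv f v x = l" unfolding dir_deriv_def by (rule limI)
  with l show ?case by simp
qed

lemma AE_diff_quot_tendsto: "AE x in lborel. (\<lambda>n. diff_quot f v n x) \<longlonglongrightarrow> dir_deriv f v x"
  using AE_dir_deriv[of v]
proof eventually_elim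
  case (elim x)
  show ?case
    using filterlim_compose[OF elim inverse_Suc_tendsto_at_0] by (simp add: diff_quot_def del: of_nat_Suc)
qed

lemma AE_dir_deriv_bound: "AE x in lborel. \<bar>dir_deriv f v x\<bar> \<le> L * norm v"
  using AE_diff_quot_tendsto[of v]
proof eventually_elim
  case (elim x)
  then have "(\<lambda>n. \<bar>diff_quot f v n x\<bar>) \<longlonglongrightarrow> \<bar>dir_deriv f v x\<bar>" by (intro tendsto_intros)
  then show ?case by (rule tendsto_upperbound) (auto simp: diff_quot_bound)
qed

end

section \<open>Rademacher's theorem\<close>

lemma integrable_indicator_mult:
  fixes g :: "'a::euclidean_space \<Rightarrow> real"
  assumes S: "bounded S" "S \<in> sets borel" and g: "g \<in> borel_measurable borel"
    and bnd: "AE x in lborel. \<bar>g x\<bar> \<le> c"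
  shows "integrable lborel (\<lambda>x. indicator S x * g x)"
proof (rule Bochner_Integration.integrable_bound[where f = "\<lambda>x. indicator S x * c"])
  have "emeasure lborel S < \<infinity>" using S(1) by (rule emeasure_bounded_finite)
  then show "integrable lborel (\<lambda>x. indicator S x * c)"
    using S(2) by (intro integrable_mult_left) (simp add: integrable_indicator_iff)
  show "(\<lambda>x. indicator S x * g x) \<in> borel_measurable lborel" using S g by measurable
  show "AE x in lborel. norm (indicator S x * g x) \<le> norm (indicator S x * c)"
    using bnd by eventually_elim (auto simp: indicator_def)
qed

lemma integral_lborel_translate:
  fixes g :: "'a::euclidean_space \<Rightarrow> real"
  assumes g: "g \<in> borel_measurable borel"
  shows "(LINT x|lborel. g (x + c)) = (LINT x|lborel. g x)"
proof -
  have "(LINT x|lborel. g x) = (LINT x|distr lborel borel ((+) c). g x)"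
    unfolding lborel_distr_plus by simp
  also have "\<dots> = (LINT x|lborel. g (c + x))"
    using g by (subst integral_distr) auto
  finally show ?thesis by (simp add: add.commute)
qed

text \<open>A measure with density \<open>1 + g / c'\<close> agrees with Lebesgue measure on boxes, hence equals it, and
  densities are unique.\<close>

lemma AE_eq_0_if_box_integrals_0:
  fixes g :: "'a::euclidean_space \<Rightarrow> real"
  assumes g [measurable]: "g \<in> borel_measurable borel"
    and bnd: "AE x in lborel. \<bar>g x\<bar> \<le> c"
    and zero: "\<And>a b. (LINT x|lborel. indicator (box a b) x * g x) = 0"
  shows "AE x in lborel. g x = 0"
proof -
  define c' where "c' = \<bar>c\<bar> + 1"
  have c': "c' > 0" by (simp add: c'_def)
  define w where "w x = 1 + g x / c'" for x
  have [measurable]: "w \<in> borel_measurable borel" unfolding w_def by measurable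
  have w0: "AE x in lborel. 0 \<le> w x"
    using bnd
  proof eventually_elim
    case (elim x)
    then have "- c' \<le> g x" by (auto simp: c'_def)
    then show ?case using c' by (simp add: w_def field_simps)
  qed
  have "lborel = density lborel (\<lambda>x. ennreal (w x))"
  proof (rule lborel_eqI)
    fix l u :: 'a assume lu: "\<And>b. b \<in> Basis \<Longrightarrow> l \<bullet> b \<le> u \<bullet> b"
    have i1: "integrable lborel (\<lambda>x. indicator (box l u) x * g x)"
      by (rule integrable_indicator_mult[OF _ _ g bnd]) (auto simp: bounded_box)
    have i2: "integrable lborel (\<lambda>x. indicator (box l u) x :: real)"
      using integrable_indicator_mult[of "box l u" "\<lambda>_. 1" 1] by (simp add: bounded_box)
    have eq: "indicator (box l u) x * w x = indicator (box l u) x + indicator (box l u) x * g x / c'" for x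
      by (simp add: w_def algebra_simps)
    have "emeasure (density lborel (\<lambda>x. ennreal (w x))) (box l u)
        = (\<integral>\<^sup>+x. ennreal (w x) * indicator (box l u) x \<partial>lborel)"
      by (rule emeasure_density) auto
    also have "\<dots> = (\<integral>\<^sup>+x. ennreal (indicator (box l u) x * w x) \<partial>lborel)"
      by (intro nn_integral_cong) (auto simp: indicator_def)
    also have "\<dots> = ennreal (LINT x|lborel. indicator (box l u) x * w x)"
    proof (rule nn_integral_eq_integral)
      show "integrable lborel (\<lambda>x. indicator (box l u) x * w x)"
        unfolding eq using i1 i2 by simp
      show "AE x in lborel. 0 \<le> indicator (box l u) x * w x"
        using w0 by eventually_elim simp
    qed
    also have "(LINT x|lborel. indicator (box l u) x * w x) = measure lborel (box l u)"
      unfolding eq using i1 i2 by (simp add: zero)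
    also have "ennreal \<dots> = emeasure lborel (box l u)"
      by (intro emeasure_eq_ennreal_measure[symmetric]) (use emeasure_lborel_box_finite[of l u] in auto)
    also have "\<dots> = (\<Prod>b\<in>Basis. (u - l) \<bullet> b)"
      using lu by (simp add: emeasure_lborel_box)
    finally show "emeasure (density lborel (\<lambda>x. ennreal (w x))) (box l u) = (\<Prod>b\<in>Basis. (u - l) \<bullet> b)" .
  qed simp
  then have "density lborel (\<lambda>x. ennreal (w x)) = density lborel (\<lambda>_. 1)"
    by (simp add: density_1)
  then have "AE x in lborel. ennreal (w x) = 1"
    using sigma_finite_measure.density_unique[OF sigma_finite_lborel, of "\<lambda>x. ennreal (w x)" "\<lambda>_. 1"] by simp
  then show ?thesis
    using w0 by eventually_elim (use c' in \<open>simp add: w_def\<close>)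
qed

context lipschitz_function
begin

lemma integrable_indicator_diff_quot:
  assumes "bounded S" "S \<in> sets borel"
  shows "integrable lborel (\<lambda>x. indicator S x * diff_quot f v n x)"
  by (rule integrable_indicator_mult[where c = "L * norm v"])
    (use assms in \<open>auto intro: diff_quot_bound\<close>)

lemma integrable_indicator_dir_deriv:
  assumes "bounded S" "S \<in> sets borel"
  shows "integrable lborel (\<lambda>x. indicator S x * dir_deriv f v x)"
  by (rule integrable_indicator_mult[OF assms _ AE_dir_deriv_bound]) measurable

text \<open>Moving the vanishing shift from the difference quotient to the box leaves a sequence that
  converges almost everywhere, since the boundary of the box is a null set.\<close>

lemma box_integral_diff_quot_shifted:
  "(\<lambda>n. LINT x|lborel. indicator (box a b) x * diff_quot f v n (x + (1 / real (Suc n)) *\<^sub>R u))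
    \<longlonglongrightarrow> (LINT x|lborel. indicator (box a b) x * dir_deriv f v x)"
proof -
  let ?s = "\<lambda>n. (1 / real (Suc n)) *\<^sub>R u"
  have "(LINT x|lborel. indicator (box a b) x * diff_quot f v n (x + ?s n))
      = (LINT x|lborel. indicator (box a b) (x - ?s n) * diff_quot f v n x)" for n
    using integral_lborel_translate[of "\<lambda>x. indicator (box a b) (x - ?s n) * diff_quot f v n x" "?s n"]
    by simp
  moreover have "(\<lambda>n. LINT x|lborel. indicator (box a b) (x - ?s n) * diff_quot f v n x)
    \<longlonglongrightarrow> (LINT x|lborel. indicator (box a b) x * dir_deriv f v x)"
  proof -
    obtain R where R: "\<And>x. x \<in> box a b \<Longrightarrow> norm x \<le> R"
      using bounded_box[of a b] unfolding bounded_iff by blast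
    let ?w = "\<lambda>x. indicator (cball 0 (R + norm u)) x * (L * norm v)"
    have "norm (?s n) \<le> norm u" for n
      using mult_right_mono[of "1 / real (Suc n)" 1 "norm u"] by simp
    then have out: "norm x \<le> R + norm u" if "x - ?s n \<in> box a b" for x n
      using R[OF that] norm_triangle_ineq[of "x - ?s n" "?s n"] 
      by (smt (verit) diff_add_cancel)
    have s0: "(\<lambda>n. x - ?s n) \<longlonglongrightarrow> x" for x
    proof -
      have "(\<lambda>n. 1 / real (Suc n)) \<longlonglongrightarrow> 0"
        using inverse_Suc_tendsto_at_0 by (simp add: filterlim_at)
      then have "(\<lambda>n. x - ?s n) \<longlonglongrightarrow> x - 0 *\<^sub>R u" by (intro tendsto_intros)
      then show ?thesis by simp
    qed
    have "cbox a b - box a b \<in> null_sets lborel"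
      using negligible_frontier_interval[of a b] by (simp add: negligible_iff_null_sets null_sets_completion_iff)
    then have bd: "AE x in lborel. x \<notin> cbox a b - box a b" by (rule AE_not_in)
    show ?thesis
    proof (rule integral_dominated_convergence[where w = ?w])
      show "integrable lborel ?w"
        by (rule integrable_indicator_mult[where c = "\<bar>L * norm v\<bar>"]) auto
      show "AE x in lborel. norm (indicator (box a b) (x - ?s n) * diff_quot f v n x) \<le> ?w x" for n
        using diff_quot_bound[of v n] out by (intro AE_I2) (auto simp: indicator_def L_nonneg)
      show "AE x in lborel. (\<lambda>n. indicator (box a b) (x - ?s n) * diff_quot f v n x)
          \<longlonglongrightarrow> indicator (box a b) x * dir_deriv f v x"
        using bd AE_diff_quot_tendsto[of v]
      proof eventually_elim
        case (elim x)
        have "\<forall>\<^sub>F n in sequentially. indicator (box a b) (x - ?s n) = (indicator (box a b) x :: real)"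
        proof (cases "x \<in> box a b")
          case True
          have "\<forall>\<^sub>F n in sequentially. x - ?s n \<in> box a b"
            using topological_tendstoD[OF s0 open_box True] .
          then show ?thesis by eventually_elim (simp add: True)
        next
          case False
          then have "x \<in> - cbox a b" using elim(1) by auto
          then have "\<forall>\<^sub>F n in sequentially. x - ?s n \<in> - cbox a b"
            using topological_tendstoD[OF s0] by (metis closed_cbox open_Compl)
          then show ?thesis
            by eventually_elim (use False box_subset_cbox[of a b] in \<open>auto simp: indicator_def\<close>)
        qed
        then have "(\<lambda>n. indicator (box a b) (x - ?s n) :: real) \<longlonglongrightarrow> indicator (box a b) x"
          by (rule tendsto_eventually)
        then show ?case using elim(2) by (rule tendsto_mult)
      qed
    qed measurable
  qed
  ultimately show ?thesis by simp
qed

lemma box_integral_diff_quot: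
  "(\<lambda>n. LINT x|lborel. indicator (box a b) x * diff_quot f v n x)
    \<longlonglongrightarrow> (LINT x|lborel. indicator (box a b) x * dir_deriv f v x)"
  using box_integral_diff_quot_shifted[of a b v 0] by simp

lemma diff_quot_add:
  "diff_quot f (u + v) n x = diff_quot f u n x + diff_quot f v n (x + (1 / real (Suc n)) *\<^sub>R u)"
  unfolding diff_quot_def by (simp add: scaleR_add_right add.assoc flip: distrib_right del: of_nat_Suc)

text \<open>The step \<open>u + v\<close> is the step \<open>u\<close> followed by the step \<open>v\<close> from a shifted base point. A pointwise
  limit of the shifted quotients is not available, but their integrals over boxes converge.\<close>

lemma AE_dir_deriv_add:
  "AE x in lborel. dir_deriv f (u + v) x = dir_deriv f u x + dir_deriv f v x"
proof -
  let ?I = "\<lambda>a b g. LINT x|lborel. indicator (box a b) x * g x"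
  have eq: "?I a b (dir_deriv f (u + v)) = ?I a b (dir_deriv f u) + ?I a b (dir_deriv f v)" for a b
  proof -
    have "?I a b (diff_quot f (u + v) n) = ?I a b (diff_quot f u n)
       + ?I a b (\<lambda>x. diff_quot f v n (x + (1 / real (Suc n)) *\<^sub>R u))" for n
    proof -
      have "integrable lborel (\<lambda>x. indicator (box a b) x * diff_quot f v n (x + (1 / real (Suc n)) *\<^sub>R u))"
        by (rule integrable_indicator_mult[where c = "L * norm v"])
          (auto simp: bounded_box intro: diff_quot_bound)
      then show ?thesis
        unfolding diff_quot_add distrib_left
        by (intro Bochner_Integration.integral_add integrable_indicator_diff_quot) (auto simp: bounded_box)
    qed
    then have "(\<lambda>n. ?I a b (diff_quot f (u + v) n)) \<longlonglongrightarrow> ?I a b (dir_deriv f u) + ?I a b (dir_deriv f v)"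
      by (simp only:) (intro tendsto_add box_integral_diff_quot box_integral_diff_quot_shifted)
    with box_integral_diff_quot show ?thesis by (rule LIMSEQ_unique)
  qed
  have "AE x in lborel. dir_deriv f (u + v) x - (dir_deriv f u x + dir_deriv f v x) = 0"
  proof (rule AE_eq_0_if_box_integrals_0)
    show "AE x in lborel. \<bar>dir_deriv f (u + v) x - (dir_deriv f u x + dir_deriv f v x)\<bar>
        \<le> L * norm (u + v) + (L * norm u + L * norm v)"
      using AE_dir_deriv_bound[of "u + v"] AE_dir_deriv_bound[of u] AE_dir_deriv_bound[of v]
      by eventually_elim linarith
    show "?I a b (\<lambda>x. dir_deriv f (u + v) x - (dir_deriv f u x + dir_deriv f v x)) = 0" for a b
      unfolding right_diff_distrib distrib_left
      by (simp add: integrable_indicator_dir_deriv bounded_box eq)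
  qed measurable
  then show ?thesis by eventually_elim simp
qed

lemma AE_dir_deriv_scaleR: "AE x in lborel. dir_deriv f (c *\<^sub>R v) x = c * dir_deriv f v x"
proof (cases "c = 0")
  case True
  then show ?thesis by (simp add: dir_deriv_def diff_quot_def)
next
  case False
  show ?thesis
    using AE_dir_deriv[of v] AE_dir_deriv[of "c *\<^sub>R v"]
  proof eventually_elim
    case (elim x)
    have "filterlim (\<lambda>h. h * c) (at 0) (at 0)"
      unfolding filterlim_at using False by (auto intro!: tendsto_eq_intros simp: eventually_at intro: exI[of _ 1])
    from filterlim_compose[OF elim(1) this]
    have "((\<lambda>h. c * ((f (x + (h * c) *\<^sub>R v) - f x) / (h * c))) \<longlongrightarrow> c * dir_deriv f v x) (at 0)"
      by (intro tendsto_intros)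
    also have "(\<lambda>h. c * ((f (x + (h * c) *\<^sub>R v) - f x) / (h * c))) = (\<lambda>h. (f (x + h *\<^sub>R c *\<^sub>R v) - f x) / h)"
      using False by (auto simp: fun_eq_iff)
    finally show ?case
      using elim(2) by (intro tendsto_unique[OF at_neq_bot])
  qed
qed

definition grad :: "'a \<Rightarrow> 'a"
  where "grad x = (\<Sum>b\<in>Basis. dir_deriv f b x *\<^sub>R b)"

lemma borel_grad [measurable]: "grad \<in> borel_measurable borel"
  unfolding grad_def by measurable

lemma AE_dir_deriv_eq_inner: "AE x in lborel. dir_deriv f v x = v \<bullet> grad x"
proof -
  have *: "AE x in lborel. dir_deriv f (\<Sum>b\<in>B. (v \<bullet> b) *\<^sub>R b) x = (\<Sum>b\<in>B. (v \<bullet> b) * dir_deriv f b x)"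
    if "finite B" for B
    using that
  proof (induction B rule: finite_induct)
    case empty
    then show ?case by (simp add: dir_deriv_def diff_quot_def)
  next
    case (insert b B)
    show ?case
      using insert.IH AE_dir_deriv_add[of "(v \<bullet> b) *\<^sub>R b" "\<Sum>b\<in>B. (v \<bullet> b) *\<^sub>R b"]
        AE_dir_deriv_scaleR[of "v \<bullet> b" b]
      by eventually_elim (simp add: insert.hyps)
  qed
  have "v \<bullet> grad x = (\<Sum>b\<in>Basis. (v \<bullet> b) * dir_deriv f b x)" for x
    by (simp add: grad_def inner_sum_right mult.commute)
  then show ?thesis using *[OF finite_Basis] by (simp add: euclidean_representation)
qed

text \<open>At almost every point the derivatives in a countable dense set of directions are those of a linear
  form. By compactness finitely many of these directions come close to all unit vectors, and the
  Lipschitz condition controls the error of passing to the nearest one, uniformly in the direction.\<close>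

theorem rademacher: "AE x in lborel. (f has_derivative (\<lambda>h. h \<bullet> grad x)) (at x)"
proof -
  obtain D :: "'a set" where D: "countable D" "\<And>X. open X \<Longrightarrow> X \<noteq> {} \<Longrightarrow> \<exists>d\<in>D. d \<in> X"
    using countable_dense_setE by blast
  have "AE x in lborel. \<forall>v\<in>D. ((\<lambda>h. (f (x + h *\<^sub>R v) - f x) / h) \<longlongrightarrow> v \<bullet> grad x) (at 0)"
  proof (intro AE_ball_countable[THEN iffD2] ballI D(1))
    fix v
    show "AE x in lborel. ((\<lambda>h. (f (x + h *\<^sub>R v) - f x) / h) \<longlongrightarrow> v \<bullet> grad x) (at 0)"
      using AE_dir_deriv[of v] AE_dir_deriv_eq_inner[of v] by eventually_elim simp
  qed
  then show ?thesis
  proof eventually_elim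
    case (elim x)
    let ?G = "grad x"
    show ?case
      unfolding has_derivative_at_alt
    proof (intro conjI allI impI)
      show "bounded_linear (\<lambda>h. h \<bullet> ?G)" by (rule bounded_linear_inner_left)
      fix e :: real assume e: "e > 0"
      define \<eta> where "\<eta> = e / (L + norm ?G + 1)"
      have den: "L + norm ?G + 1 > 0" using L_nonneg norm_ge_zero[of ?G] by linarith
      then have \<eta>: "\<eta> > 0" using e by (simp add: \<eta>_def)
      have "sphere 0 1 \<subseteq> (\<Union>v\<in>D. ball v \<eta>)"
      proof
        fix w :: 'a
        have "ball w \<eta> \<noteq> {}" using \<eta> by simp
        then obtain v where "v \<in> D" "v \<in> ball w \<eta>" using D(2)[OF open_ball] by blast
        then show "w \<in> (\<Union>v\<in>D. ball v \<eta>)" by (auto simp: dist_commute)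
      qed
      then obtain D' where D': "D' \<subseteq> D" "finite D'" "sphere 0 1 \<subseteq> (\<Union>v\<in>D'. ball v \<eta>)"
        using compactE_image[OF compact_sphere, of D "\<lambda>v. ball v \<eta>" 0 1] by (metis open_ball)
      have "\<forall>\<^sub>F h in at 0. \<forall>v\<in>D'. dist ((f (x + h *\<^sub>R v) - f x) / h) (v \<bullet> ?G) < \<eta>"
        using D' elim \<eta> by (intro eventually_ball_finite) (auto intro: tendstoD)
      then obtain d where d: "d > 0"
        "\<And>h v. h \<noteq> 0 \<Longrightarrow> \<bar>h\<bar> < d \<Longrightarrow> v \<in> D' \<Longrightarrow> \<bar>(f (x + h *\<^sub>R v) - f x) / h - v \<bullet> ?G\<bar> < \<eta>"
        unfolding eventually_at by (auto simp: dist_real_def)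
      have "norm (f y - f x - (y - x) \<bullet> ?G) \<le> e * norm (y - x)" if y: "norm (y - x) < d" for y
      proof (cases "y = x")
        case False
        define h where "h = norm (y - x)"
        define w where "w = (1 / h) *\<^sub>R (y - x)"
        have h: "h > 0" using False by (simp add: h_def)
        have yx: "y = x + h *\<^sub>R w" using h by (simp add: w_def)
        have "w \<in> sphere 0 1" using h by (simp add: w_def h_def)
        then obtain v where v: "v \<in> D'" "norm (v - w) < \<eta>"
          using D'(3) by (auto simp: dist_norm)
        have 1: "\<bar>f (x + h *\<^sub>R w) - f (x + h *\<^sub>R v)\<bar> \<le> L * (h * \<eta>)"
        proof -
          have "norm (x + h *\<^sub>R w - (x + h *\<^sub>R v)) = h * norm (v - w)"
            using h by (simp add: norm_minus_commute flip: scaleR_right_diff_distrib)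
          then show ?thesis
            using lip_norm[of "x + h *\<^sub>R w" "x + h *\<^sub>R v"] v h L_nonneg
            by (smt (verit) mult_left_mono)
        qed
        have 2: "\<bar>f (x + h *\<^sub>R v) - f x - h * (v \<bullet> ?G)\<bar> \<le> h * \<eta>"
        proof -
          have "\<bar>(f (x + h *\<^sub>R v) - f x) / h - v \<bullet> ?G\<bar> \<le> \<eta>"
            using d(2)[OF _ _ v(1), of h] h y by (simp add: h_def)
          then have "h * \<bar>(f (x + h *\<^sub>R v) - f x) / h - v \<bullet> ?G\<bar> \<le> h * \<eta>"
            using h by (intro mult_left_mono) auto
          also have "h * \<bar>(f (x + h *\<^sub>R v) - f x) / h - v \<bullet> ?G\<bar>
            = \<bar>h * ((f (x + h *\<^sub>R v) - f x) / h - v \<bullet> ?G)\<bar>"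
            using h by (simp add: abs_mult)
          also have "h * ((f (x + h *\<^sub>R v) - f x) / h - v \<bullet> ?G) = f (x + h *\<^sub>R v) - f x - h * (v \<bullet> ?G)"
            using h by (simp add: field_simps)
          finally show ?thesis .
        qed
        have 3: "\<bar>h * ((v - w) \<bullet> ?G)\<bar> \<le> h * (\<eta> * norm ?G)"
        proof -
          have "\<bar>(v - w) \<bullet> ?G\<bar> \<le> norm (v - w) * norm ?G" by (rule Cauchy_Schwarz_ineq2)
          also have "\<dots> \<le> \<eta> * norm ?G" using v by (intro mult_right_mono) auto
          finally show ?thesis using h by (simp add: abs_mult)
        qed
        have "f y - f x - (y - x) \<bullet> ?G = (f (x + h *\<^sub>R w) - f (x + h *\<^sub>R v))
           + (f (x + h *\<^sub>R v) - f x - h * (v \<bullet> ?G)) + h * ((v - w) \<bullet> ?G)"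
          by (simp add: yx inner_diff_left algebra_simps)
        then have "norm (f y - f x - (y - x) \<bullet> ?G) \<le> L * (h * \<eta>) + h * \<eta> + h * (\<eta> * norm ?G)"
          using 1 2 3 unfolding real_norm_def by linarith
        also have "\<dots> = h * ((L + norm ?G + 1) * \<eta>)" by (simp add: algebra_simps)
        also have "(L + norm ?G + 1) * \<eta> = e" using den by (simp add: \<eta>_def)
        finally show ?thesis by (simp add: h_def mult.commute)
      qed simp
      then show "\<exists>d>0. \<forall>y. norm (y - x) < d \<longrightarrow> norm (f y - f x - (y - x) \<bullet> ?G) \<le> e * norm (y - x)"
        using d(1) by blast
    qed
  qed
qed

lemma AE_grad_bound: "AE x in lborel. norm (grad x) \<le> (\<Sum>b\<in>(Basis::'a set). L)"
proof -
  have "AE x in lborel. \<forall>b\<in>(Basis::'a set). \<bar>dir_deriv f b x\<bar> \<le> L * norm b"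
    by (intro AE_ball_countable[THEN iffD2] ballI AE_dir_deriv_bound countable_finite) simp
  then show ?thesis
  proof eventually_elim
    case (elim x)
    have "norm (grad x) \<le> (\<Sum>b\<in>Basis. norm (dir_deriv f b x *\<^sub>R b))"
      unfolding grad_def by (rule norm_sum)
    also have "\<dots> \<le> (\<Sum>b\<in>(Basis::'a set). L)"
      using elim by (intro sum_mono) auto
    finally show ?case .
  qed
qed

lemma integrable_indicator_grad:
  assumes "bounded S" "S \<in> sets borel"
  shows "integrable lborel (\<lambda>x. indicator S x * norm (grad x))"
  by (rule integrable_indicator_mult[OF assms]) (use AE_grad_bound in auto)

end

section \<open>Increments averaged over a translated set\<close>

lemma abs_integral_le:
  fixes f g :: "'a \<Rightarrow> real"
  assumes "integrable M f" "integrable M g" "\<And>x. \<bar>f x\<bar> \<le> g x"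
  shows "\<bar>integral\<^sup>L M f\<bar> \<le> integral\<^sup>L M g"
  using integral_abs_bound[of M f] integral_mono[OF integrable_abs[OF assms(1)] assms(2,3)] 
  by linarith

lemma vimage_diff_eq_translation: "(\<lambda>x. x - c) -` P = (+) (c::'a::real_vector) ` P"
proof (intro equalityI subsetI)
  fix x assume "x \<in> (\<lambda>x. x - c) -` P"
  then show "x \<in> (+) c ` P" by (intro image_eqI[of _ _ "x - c"]) auto
qed auto

lemma card_nat_le_if_spread:
  fixes J :: "nat set"
  assumes fin: "finite J" and spread: "\<And>i j. i \<in> J \<Longrightarrow> j \<in> J \<Longrightarrow> i \<le> j \<Longrightarrow> real (j - i) \<le> s" and s: "0 \<le> s"
  shows "real (card J) \<le> s + 1"
proof (cases "J = {}")
  case False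
  have le: "Min J \<le> Max J" using fin False by simp
  have "J \<subseteq> {Min J..Max J}" using fin by auto
  then have "card J \<le> Max J - Min J + 1"
    using card_mono[of "{Min J..Max J}" J] le by simp
  moreover have "real (Max J - Min J) \<le> s"
    using fin False le by (intro spread) auto
  ultimately show ?thesis by linarith
qed (use s in simp)

context lipschitz_function
begin

text \<open>The step \<open>v\<close> is divided into \<open>Suc n\<close> equal steps; translation invariance then moves the base points
  of all of them to \<open>x\<close> at the expense of translating \<open>P\<close>.\<close>

lemma integral_increment_telescope:
  assumes P: "bounded P" "P \<in> sets borel"
  shows "(LINT x|lborel. indicator P x * (f (x + v) - f x)) =
    (\<Sum>j<Suc n. LINT x|lborel. indicator P (x - (j / real (Suc n)) *\<^sub>R v) * diff_quot f v n x) / real (Suc n)"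
proof -
  let ?m = "real (Suc n)"
  have m: "?m > 0" by simp
  have incr: "f (x + v) - f x = (\<Sum>j<Suc n. diff_quot f v n (x + (j / ?m) *\<^sub>R v)) / ?m" for x
  proof -
    have "diff_quot f v n (x + (j / ?m) *\<^sub>R v) = (f (x + (real (Suc j) / ?m) *\<^sub>R v) - f (x + (j / ?m) *\<^sub>R v)) * ?m" for j
    proof -
      have "x + (j / ?m) *\<^sub>R v + (1 / ?m) *\<^sub>R v = x + (real (Suc j) / ?m) *\<^sub>R v"
        by (simp add: add.assoc add_divide_distrib add.commute flip: scaleR_left_distrib)
      then show ?thesis by (simp only: diff_quot_def)
    qed
    then have "(\<Sum>j<Suc n. diff_quot f v n (x + (j / ?m) *\<^sub>R v))
      = (\<Sum>j<Suc n. f (x + (real (Suc j) / ?m) *\<^sub>R v) - f (x + (j / ?m) *\<^sub>R v)) * ?m"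
      by (simp only: sum_distrib_right)
    also have "(\<Sum>j<Suc n. f (x + (real (Suc j) / ?m) *\<^sub>R v) - f (x + (j / ?m) *\<^sub>R v))
      = f (x + (real (Suc n) / ?m) *\<^sub>R v) - f (x + (real 0 / ?m) *\<^sub>R v)"
      by (rule sum_lessThan_telescope)
    also have "\<dots> = f (x + v) - f x" using m by (simp del: of_nat_Suc)
    finally show ?thesis using m by (simp del: of_nat_Suc)
  qed
  have int: "integrable lborel (\<lambda>x. indicator P x * diff_quot f v n (x + c))" for c
    by (rule integrable_indicator_mult[OF P, where c = "L * norm v"]) (auto intro: diff_quot_bound)
  have tr: "(LINT x|lborel. indicator P x * diff_quot f v n (x + (j / ?m) *\<^sub>R v))
    = (LINT x|lborel. indicator P (x - (j / ?m) *\<^sub>R v) * diff_quot f v n x)" for j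
    using P(2) integral_lborel_translate[of "\<lambda>x. indicator P (x - (j / ?m) *\<^sub>R v) * diff_quot f v n x" "(j / ?m) *\<^sub>R v"]
    by simp
  have "(LINT x|lborel. indicator P x * (f (x + v) - f x))
    = (LINT x|lborel. (\<Sum>j<Suc n. indicator P x * diff_quot f v n (x + (j / ?m) *\<^sub>R v)) / ?m)"
    unfolding incr by (simp only: times_divide_eq_right sum_distrib_left)
  also have "\<dots> = (\<Sum>j<Suc n. LINT x|lborel. indicator P x * diff_quot f v n (x + (j / ?m) *\<^sub>R v)) / ?m"
    by (simp only: integral_divide_zero Bochner_Integration.integral_sum[OF int])
  finally show ?thesis by (simp only: tr)
qed

lemma indicator_mult_diff_quot_limit:
  fixes \<phi> :: "real \<Rightarrow> real"
  assumes Q: "bounded Q" "Q \<in> sets borel"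
    and \<phi>: "continuous_on UNIV \<phi>" "\<And>t. \<bar>t\<bar> \<le> L * norm v \<Longrightarrow> \<bar>\<phi> t\<bar> \<le> c"
  shows "(\<lambda>n. LINT x|lborel. indicator Q x * \<phi> (diff_quot f v n x))
    \<longlonglongrightarrow> (LINT x|lborel. indicator Q x * \<phi> (dir_deriv f v x))"
proof (rule integral_dominated_convergence[where w = "\<lambda>x. indicator Q x * c"])
  have [measurable]: "\<phi> \<in> borel_measurable borel" using \<phi>(1) by (rule borel_measurable_continuous_onI)
  show "(\<lambda>x. indicator Q x * \<phi> (dir_deriv f v x)) \<in> borel_measurable lborel"
    "(\<lambda>x. indicator Q x * \<phi> (diff_quot f v n x)) \<in> borel_measurable lborel" for n
    using Q by measurable
  show "integrable lborel (\<lambda>x. indicator Q x * c)"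
    by (rule integrable_indicator_mult[OF Q, where c = "\<bar>c\<bar>"]) auto
  show "AE x in lborel. norm (indicator Q x * \<phi> (diff_quot f v n x)) \<le> indicator Q x * c" for n
    using \<phi>(2)[OF diff_quot_bound] by (auto simp: indicator_def intro!: AE_I2)
  show "AE x in lborel. (\<lambda>n. indicator Q x * \<phi> (diff_quot f v n x))
      \<longlonglongrightarrow> indicator Q x * \<phi> (dir_deriv f v x)"
    using AE_diff_quot_tendsto[of v]
  proof eventually_elim
    case (elim x)
    have "isCont \<phi> (dir_deriv f v x)" using \<phi>(1) by (simp add: continuous_on_eq_continuous_at)
    then show ?case using elim by (intro tendsto_mult tendsto_const isCont_tendsto_compose[of _ \<phi>])
  qed
qed

text \<open>In the telescoped integral a point \<open>x\<close> of \<open>Q\<close> is counted once for every \<open>j\<close> such that the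
  \<open>j\<close>-th translate of \<open>P\<close> contains it. These translates advance by \<open>norm v / Suc n\<close> each time and have
  diameter at most \<open>D\<close>, so there are at most \<open>Suc n * D / norm v + 1\<close> of them. The factor \<open>norm v\<close>
  cancels against the size of the directional derivative.\<close>

lemma integral_increment_le_gradient:
  assumes P: "bounded P" "P \<in> sets borel" and Q: "bounded Q" "Q \<in> sets borel"
    and seg: "\<And>x t. x \<in> P \<Longrightarrow> 0 \<le> t \<Longrightarrow> t \<le> 1 \<Longrightarrow> x + t *\<^sub>R v \<in> Q"
    and diam: "\<And>x y. x \<in> P \<Longrightarrow> y \<in> P \<Longrightarrow> norm (x - y) \<le> D" and D: "0 \<le> D"
  shows "\<bar>LINT x|lborel. indicator P x * (f (x + v) - f x)\<bar>
    \<le> D * (LINT x|lborel. indicator Q x * norm (grad x))"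
proof (cases "v = 0")
  case True
  then show ?thesis using D by (simp add: integral_nonneg_AE)
next
  case False
  let ?I = "LINT x|lborel. indicator P x * (f (x + v) - f x)"
  have count: "(\<Sum>j<Suc n. indicator P (x - (j / real (Suc n)) *\<^sub>R v))
      \<le> real (Suc n) * (D / norm v) + 1" for n x
  proof -
    let ?m = "real (Suc n)"
    define J where "J = {j. j < Suc n \<and> x - (j / ?m) *\<^sub>R v \<in> P}"
    have "(\<Sum>j<Suc n. indicator P (x - (j / ?m) *\<^sub>R v)) = real (card J)"
    proof -
      have "(\<Sum>j<Suc n. indicator P (x - (j / ?m) *\<^sub>R v)) = (\<Sum>j\<in>J. 1::real)"
        by (rule sum.mono_neutral_cong_right) (auto simp: J_def)
      then show ?thesis by simp
    qed
    also have "\<dots> \<le> ?m * (D / norm v) + 1"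
    proof (rule card_nat_le_if_spread)
      show "finite J" by (simp add: J_def)
      fix i j assume ij: "i \<in> J" "j \<in> J" "i \<le> j"
      have "real (j - i) / ?m * norm v = norm ((x - (i / ?m) *\<^sub>R v) - (x - (j / ?m) *\<^sub>R v))"
      proof -
        have "(x - (i / ?m) *\<^sub>R v) - (x - (j / ?m) *\<^sub>R v) = (real (j - i) / ?m) *\<^sub>R v"
          using ij by (simp add: of_nat_diff diff_divide_distrib scaleR_left_diff_distrib del: of_nat_Suc)
        then show ?thesis by (simp del: of_nat_Suc)
      qed
      also have "\<dots> \<le> D" using ij by (intro diam) (auto simp: J_def)
      finally show "real (j - i) \<le> ?m * (D / norm v)"
        using False by (simp add: field_simps del: of_nat_Suc)
    qed (use D in simp)
    finally show ?thesis .
  qed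
  have intQ: "integrable lborel (\<lambda>x. indicator Q x * \<bar>diff_quot f v n x\<bar>)" for n
    by (rule integrable_indicator_mult[OF Q, where c = "L * norm v"]) (auto intro: diff_quot_bound)
  have step: "\<bar>?I\<bar> \<le> (D / norm v + 1 / real (Suc n)) * (LINT x|lborel. indicator Q x * \<bar>diff_quot f v n x\<bar>)" for n
  proof -
    let ?m = "real (Suc n)"
    have m: "?m > 0" by simp
    have intP: "integrable lborel (\<lambda>x. indicator P (x - c) * diff_quot f v n x)" for c
    proof -
      have "(\<lambda>x. indicator P (x - c) * diff_quot f v n x) = (\<lambda>x. indicator ((+) c ` P) x * diff_quot f v n x)"
        unfolding vimage_diff_eq_translation[symmetric] by (simp add: indicator_vimage)
      moreover have "(\<lambda>x. x - c) -` P \<in> sets borel" using measurable_sets[of "\<lambda>x. x - c" borel borel P] P(2) by simp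
      ultimately show ?thesis
        using integrable_indicator_diff_quot[of "(+) c ` P"] bounded_translation[OF P(1)]
        by (simp add: vimage_diff_eq_translation)
    qed
    have "\<bar>?I\<bar> = \<bar>\<Sum>j<Suc n. LINT x|lborel. indicator P (x - (j / ?m) *\<^sub>R v) * diff_quot f v n x\<bar> / ?m"
      unfolding integral_increment_telescope[OF P, of v n] using m by (simp only: abs_divide abs_of_pos)
    also have "(\<Sum>j<Suc n. LINT x|lborel. indicator P (x - (j / ?m) *\<^sub>R v) * diff_quot f v n x)
      = (LINT x|lborel. (\<Sum>j<Suc n. indicator P (x - (j / ?m) *\<^sub>R v) * diff_quot f v n x))"
      by (rule Bochner_Integration.integral_sum[symmetric]) (rule intP)
    also have "\<bar>\<dots>\<bar> \<le> (LINT x|lborel. (?m * (D / norm v) + 1) * (indicator Q x * \<bar>diff_quot f v n x\<bar>))"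
    proof (rule abs_integral_le)
      show "integrable lborel (\<lambda>x. \<Sum>j<Suc n. indicator P (x - (j / ?m) *\<^sub>R v) * diff_quot f v n x)"
        by (intro Bochner_Integration.integrable_sum intP)
      show "integrable lborel (\<lambda>x. (?m * (D / norm v) + 1) * (indicator Q x * \<bar>diff_quot f v n x\<bar>))"
        by (intro integrable_mult_right intQ)
      fix x
      have "\<bar>\<Sum>j<Suc n. indicator P (x - (j / ?m) *\<^sub>R v) * diff_quot f v n x\<bar>
         = (\<Sum>j<Suc n. indicator P (x - (j / ?m) *\<^sub>R v)) * \<bar>diff_quot f v n x\<bar>"
        by (simp only: sum_distrib_right[symmetric] abs_mult) (simp add: sum_nonneg abs_of_nonneg)
      also have "\<dots> \<le> (?m * (D / norm v) + 1) * (indicator Q x * \<bar>diff_quot f v n x\<bar>)"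
      proof (cases "x \<in> Q")
        case True
        then show ?thesis using count[where x = x and n = n] by (simp add: mult_right_mono del: sum.lessThan_Suc)
      next
        case False
        have "x - (j / ?m) *\<^sub>R v \<notin> P" if "j < Suc n" for j
          using seg[of "x - (j / ?m) *\<^sub>R v" "j / ?m"] that False by auto
        then have "(\<Sum>j<Suc n. indicator P (x - (j / ?m) *\<^sub>R v)) = (0::real)"
          by (intro sum.neutral) auto
        then show ?thesis using False by simp
      qed
      finally show "\<bar>\<Sum>j<Suc n. indicator P (x - (j / ?m) *\<^sub>R v) * diff_quot f v n x\<bar>
        \<le> (?m * (D / norm v) + 1) * (indicator Q x * \<bar>diff_quot f v n x\<bar>)" .
    qed
    finally have "\<bar>?I\<bar> \<le> (?m * (D / norm v) + 1) * (LINT x|lborel. indicator Q x * \<bar>diff_quot f v n x\<bar>) / ?m"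
      using m by (simp add: divide_right_mono del: of_nat_Suc)
    also have "\<dots> = (D / norm v + 1 / ?m) * (LINT x|lborel. indicator Q x * \<bar>diff_quot f v n x\<bar>)"
      using m by (simp add: field_simps del: of_nat_Suc)
    finally show ?thesis .
  qed
  have "(\<lambda>n. 1 / real (Suc n)) \<longlonglongrightarrow> 0"
    using inverse_Suc_tendsto_at_0 by (simp add: filterlim_at)
  then have "(\<lambda>n. (D / norm v + 1 / real (Suc n)) * (LINT x|lborel. indicator Q x * \<bar>diff_quot f v n x\<bar>))
    \<longlonglongrightarrow> (D / norm v + 0) * (LINT x|lborel. indicator Q x * \<bar>dir_deriv f v x\<bar>)"
    by (intro tendsto_intros indicator_mult_diff_quot_limit[OF Q, of abs _ "L * norm v"] continuous_intros) auto
  then have "\<bar>?I\<bar> \<le> (D / norm v + 0) * (LINT x|lborel. indicator Q x * \<bar>dir_deriv f v x\<bar>)"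
    by (rule tendsto_lowerbound) (use step in auto)
  also have "(LINT x|lborel. indicator Q x * \<bar>dir_deriv f v x\<bar>)
    \<le> (LINT x|lborel. norm v * (indicator Q x * norm (grad x)))"
  proof (rule integral_mono_AE)
    show "integrable lborel (\<lambda>x. indicator Q x * \<bar>dir_deriv f v x\<bar>)"
      by (rule integrable_indicator_mult[OF Q, where c = "L * norm v"]) (use AE_dir_deriv_bound[of v] in auto)
    show "integrable lborel (\<lambda>x. norm v * (indicator Q x * norm (grad x)))"
      by (intro integrable_mult_right integrable_indicator_grad Q)
    show "AE x in lborel. indicator Q x * \<bar>dir_deriv f v x\<bar> \<le> norm v * (indicator Q x * norm (grad x))"
      using AE_dir_deriv_eq_inner[of v]
      by eventually_elim (auto simp: indicator_def Cauchy_Schwarz_ineq2)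
  qed
  also have "\<dots> = norm v * (LINT x|lborel. indicator Q x * norm (grad x))" by simp
  finally show ?thesis using False D by (simp add: mult_left_mono divide_right_mono)
qed

text \<open>The difference quotients exceed \<open>M * norm v\<close> only by an amount that tends to \<open>0\<close> almost everywhere,
  so the part of the telescoped integral above this level vanishes in the limit.\<close>

lemma integral_increment_le_sup:
  assumes P: "bounded P" "P \<in> sets borel" and Q: "bounded Q" "Q \<in> sets borel"
    and seg: "\<And>x t. x \<in> P \<Longrightarrow> 0 \<le> t \<Longrightarrow> t \<le> 1 \<Longrightarrow> x + t *\<^sub>R v \<in> Q"
    and M: "AE x in lborel. x \<in> Q \<longrightarrow> norm (grad x) \<le> M"
  shows "\<bar>LINT x|lborel. indicator P x * (f (x + v) - f x)\<bar> \<le> M * norm v * measure lborel P"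
proof -
  let ?I = "LINT x|lborel. indicator P x * (f (x + v) - f x)"
  let ?h = "\<lambda>t. max 0 (\<bar>t\<bar> - M * norm v)"
  have h_bound: "\<bar>?h t\<bar> \<le> L * norm v + \<bar>M * norm v\<bar>" if "\<bar>t\<bar> \<le> L * norm v" for t
    using that by linarith
  have step: "\<bar>?I\<bar> \<le> M * norm v * measure lborel P + (LINT x|lborel. indicator Q x * ?h (diff_quot f v n x))" (is "_ \<le> ?B") for n
  proof -
    let ?m = "real (Suc n)"
    have m: "?m > 0" by simp
    have "\<bar>LINT x|lborel. indicator P (x - (j / ?m) *\<^sub>R v) * diff_quot f v n x\<bar> \<le> ?B" if "j < Suc n" for j
    proof -
      let ?c = "(j / ?m) *\<^sub>R v"
      let ?P = "(\<lambda>x. x - ?c) -` P"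
      have P': "?P \<in> sets borel" using measurable_sets[of "\<lambda>x. x - ?c" borel borel P] P(2) by simp
      have b: "bounded ?P"
        unfolding vimage_diff_eq_translation by (rule bounded_translation[OF P(1)])
      have mP: "measure lborel ?P = measure lborel P"
      proof -
        have "(LINT x|lborel. indicator ?P (x + ?c)) = (LINT x|lborel. indicator ?P x :: real)"
          using P' by (intro integral_lborel_translate) simp
        also have "(\<lambda>x. indicator ?P (x + ?c) :: real) = indicator P"
          by (auto simp: indicator_def)
        finally show ?thesis by simp
      qed
      have i1: "integrable lborel (\<lambda>x. indicator ?P x * (M * norm v))"
        by (rule integrable_indicator_mult[OF b P', where c = "\<bar>M * norm v\<bar>"]) auto
      have i2: "integrable lborel (\<lambda>x. indicator Q x * ?h (diff_quot f v n x))"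
      proof (rule integrable_indicator_mult[OF Q])
        show "AE x in lborel. \<bar>?h (diff_quot f v n x)\<bar> \<le> L * norm v + \<bar>M * norm v\<bar>"
          by (intro AE_I2 h_bound diff_quot_bound)
      qed measurable
      have "\<bar>LINT x|lborel. indicator ?P x * diff_quot f v n x\<bar>
        \<le> (LINT x|lborel. indicator ?P x * (M * norm v) + indicator Q x * ?h (diff_quot f v n x))"
      proof (rule abs_integral_le)
        show "integrable lborel (\<lambda>x. indicator ?P x * diff_quot f v n x)"
          by (rule integrable_indicator_diff_quot[OF b P'])
        show "integrable lborel (\<lambda>x. indicator ?P x * (M * norm v) + indicator Q x * ?h (diff_quot f v n x))"
          by (rule Bochner_Integration.integrable_add[OF i1 i2])
        fix x
        have "x \<in> Q" if "x \<in> ?P"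
          using seg[of "x - ?c" "j / ?m"] that \<open>j < Suc n\<close> by auto
        then show "\<bar>indicator ?P x * diff_quot f v n x\<bar>
            \<le> indicator ?P x * (M * norm v) + indicator Q x * ?h (diff_quot f v n x)"
          by (auto simp: indicator_def max_def)
      qed
      also have "\<dots> = ?B"
      proof -
        have "(LINT x|lborel. indicator ?P x * (M * norm v)) = measure lborel ?P * (M * norm v)"
          using P' by simp
        then show ?thesis
          unfolding Bochner_Integration.integral_add[OF i1 i2] mP by (simp only: mult.commute)
      qed
      finally show ?thesis by (simp add: indicator_vimage)
    qed
    then have "\<bar>\<Sum>j<Suc n. LINT x|lborel. indicator P (x - (j / ?m) *\<^sub>R v) * diff_quot f v n x\<bar> \<le> (\<Sum>j<Suc n. ?B)"
      by (intro order_trans[OF sum_abs] sum_mono) auto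
    then show ?thesis
      unfolding integral_increment_telescope[OF P, of v n] abs_divide
      by (simp add: divide_le_eq mult.commute)
  qed
  have "(\<lambda>n. M * norm v * measure lborel P + (LINT x|lborel. indicator Q x * ?h (diff_quot f v n x)))
    \<longlonglongrightarrow> M * norm v * measure lborel P + (LINT x|lborel. indicator Q x * ?h (dir_deriv f v x))"
    by (intro tendsto_intros indicator_mult_diff_quot_limit[OF Q, of _ _ "L * norm v + \<bar>M * norm v\<bar>"] continuous_intros h_bound)
  then have "\<bar>?I\<bar> \<le> M * norm v * measure lborel P + (LINT x|lborel. indicator Q x * ?h (dir_deriv f v x))"
    by (rule tendsto_lowerbound) (use step in auto)
  also have "(LINT x|lborel. indicator Q x * ?h (dir_deriv f v x)) = (LINT x|(lborel :: 'a measure). 0)"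
  proof (rule Bochner_Integration.integral_cong_AE)
    show "AE x in lborel. indicator Q x * ?h (dir_deriv f v x) = 0"
      using M AE_dir_deriv_eq_inner[of v]
    proof eventually_elim
      case (elim x)
      show ?case
      proof (cases "x \<in> Q")
        case True
        then have "\<bar>dir_deriv f v x\<bar> \<le> norm v * M"
          using elim order_trans[OF Cauchy_Schwarz_ineq2[of v "grad x"] mult_left_mono[of "norm (grad x)" M "norm v"]]
          by simp
        then show ?thesis by (simp add: max_def mult.commute)
      qed simp
    qed
  qed (use Q in measurable)
  finally show ?thesis by simp
qed

end

section \<open>Increments of a Lipschitz function on a convex body\<close>

text \<open>The set \<open>P\<close> is the copy of \<open>C\<close> shrunk by the factor \<open>e\<close> towards \<open>a\<close>. Translation by
  \<open>(1 - e) *\<^sub>R (b - a)\<close> carries it to the copy shrunk towards \<open>b\<close>, and convexity keeps all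
  intermediate positions inside \<open>C\<close>.\<close>

lemma homothety_convex:
  fixes C :: "'a::euclidean_space set"
  assumes C: "compact C" "convex C" and a: "a \<in> C" and e: "0 \<le> e" "e \<le> 1"
    and diam: "\<forall>x\<in>C. \<forall>y\<in>C. norm (x - y) \<le> \<Delta>"
  defines "P \<equiv> (\<lambda>c. (1 - e) *\<^sub>R a + e *\<^sub>R c) ` C"
  shows "bounded P" "P \<in> sets borel" "measure lborel P = e ^ DIM('a) * measure lborel C"
    "\<And>x y. x \<in> P \<Longrightarrow> y \<in> P \<Longrightarrow> norm (x - y) \<le> e * \<Delta>"
    "\<And>x. x \<in> P \<Longrightarrow> norm (x - a) \<le> e * \<Delta>"
    "\<And>x b t. x \<in> P \<Longrightarrow> b \<in> C \<Longrightarrow> 0 \<le> t \<Longrightarrow> t \<le> 1 \<Longrightarrow>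
      x + t *\<^sub>R ((1 - e) *\<^sub>R (b - a)) \<in> C"
    "\<And>x b. x \<in> P \<Longrightarrow> b \<in> C \<Longrightarrow> norm (x + (1 - e) *\<^sub>R (b - a) - b) \<le> e * \<Delta>"
proof -
  have "compact P" unfolding P_def
    by (intro compact_continuous_image C continuous_intros)
  then show "bounded P" "P \<in> sets borel" by (auto intro: compact_imp_bounded borel_compact)
  have "measure lebesgue P = e ^ DIM('a) * measure lebesgue C"
    unfolding P_def using measure_lebesgue_affine[of e "(1 - e) *\<^sub>R a" C] e 
    by (simp add: add.commute)
  then show "measure lborel P = e ^ DIM('a) * measure lborel C"
    using \<open>P \<in> sets borel\<close> borel_compact[OF C(1)] by simp
  show "norm (x - y) \<le> e * \<Delta>" if xy: "x \<in> P" "y \<in> P" for x y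
  proof -
    obtain c c' where "c \<in> C" "x = (1 - e) *\<^sub>R a + e *\<^sub>R c" "c' \<in> C" "y = (1 - e) *\<^sub>R a + e *\<^sub>R c'"
      using xy by (auto simp: P_def)
    moreover from this have "x - y = e *\<^sub>R (c - c')" by (simp add: scaleR_right_diff_distrib)
    ultimately show ?thesis using e diam by (simp add: mult_left_mono)
  qed
  show "norm (x - a) \<le> e * \<Delta>" if x: "x \<in> P" for x
  proof -
    obtain c where c: "c \<in> C" "x = (1 - e) *\<^sub>R a + e *\<^sub>R c"
      using x by (auto simp: P_def)
    then have "x - a = e *\<^sub>R (c - a)" by (simp add: algebra_simps)
    then show ?thesis using e diam c(1) a by (simp add: mult_left_mono)
  qed
  show "x + t *\<^sub>R ((1 - e) *\<^sub>R (b - a)) \<in> C" if x: "x \<in> P" and b: "b \<in> C" and t: "0 \<le> t" "t \<le> 1" for x b t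
  proof -
    obtain c where c: "c \<in> C" "x = (1 - e) *\<^sub>R a + e *\<^sub>R c"
      using x by (auto simp: P_def)
    have "(1 - t) *\<^sub>R a + t *\<^sub>R b \<in> C" using C(2) a b t by (simp add: convexD_alt)
    then have "(1 - e) *\<^sub>R ((1 - t) *\<^sub>R a + t *\<^sub>R b) + e *\<^sub>R c \<in> C"
      using C(2) c e by (simp add: convexD_alt)
    moreover have "(1 - e) *\<^sub>R ((1 - t) *\<^sub>R a + t *\<^sub>R b) + e *\<^sub>R c = x + t *\<^sub>R ((1 - e) *\<^sub>R (b - a))"
      unfolding c by (simp add: algebra_simps)
    ultimately show ?thesis by simp
  qed
  show "norm (x + (1 - e) *\<^sub>R (b - a) - b) \<le> e * \<Delta>" if x: "x \<in> P" and b: "b \<in> C" for x b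
  proof -
    obtain c where c: "c \<in> C" "x = (1 - e) *\<^sub>R a + e *\<^sub>R c"
      using x by (auto simp: P_def)
    then have "x + (1 - e) *\<^sub>R (b - a) - b = e *\<^sub>R (c - b)" by (simp add: algebra_simps)
    then show ?thesis using e diam c(1) b by (simp add: mult_left_mono)
  qed
qed

text \<open>Tonelli: each point lies in the ball around \<open>y\<close> for a set of centres \<open>y\<close> that is itself a ball.\<close>

lemma has_bochner_integral_ball_average:
  fixes g :: "'a::euclidean_space \<Rightarrow> real"
  assumes g: "integrable lborel g" "\<And>x. 0 \<le> g x"
  shows "has_bochner_integral lborel (\<lambda>y. LINT x|lborel. indicator (cball y \<rho>) x * g x)
    (measure lborel (cball (0::'a) \<rho>) * (LINT x|lborel. g x))"
proof (rule has_bochner_integral_nn_integral)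
  have g' [measurable]: "g \<in> borel_measurable borel" using g(1) by (simp add: borel_measurable_integrable)
  have ind: "indicator (cball y \<rho>) x = (if dist y x \<le> \<rho> then 1 else 0 :: real)" for x y :: 'a
    by (simp add: indicator_def)
  show "(\<lambda>y. LINT x|lborel. indicator (cball y \<rho>) x * g x) \<in> borel_measurable lborel"
    unfolding ind by measurable
  show "AE y in lborel. 0 \<le> (LINT x|lborel. indicator (cball y \<rho>) x * g x)"
    using g by (intro AE_I2 integral_nonneg_AE) auto
  show "0 \<le> measure lborel (cball (0::'a) \<rho>) * (LINT x|lborel. g x)"
    using g by (intro mult_nonneg_nonneg integral_nonneg_AE) auto
  let ?V = "emeasure lborel (cball (0::'a) \<rho>)"
  have V: "emeasure lborel (cball x \<rho>) = ?V" for x :: 'a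
  proof -
    have "?V = emeasure (distr lborel borel ((+) (-x))) (cball (0::'a) \<rho>)"
      unfolding lborel_distr_plus ..
    also have "\<dots> = emeasure lborel (cball x \<rho>)"
      by (subst emeasure_distr) (auto intro!: arg_cong[where f = "emeasure lborel"] simp: dist_norm norm_minus_commute)
    finally show ?thesis ..
  qed
  have "(\<integral>\<^sup>+y. ennreal (LINT x|lborel. indicator (cball y \<rho>) x * g x) \<partial>lborel)
    = (\<integral>\<^sup>+y. (\<integral>\<^sup>+x. ennreal ((if dist y x \<le> \<rho> then 1 else 0) * g x) \<partial>lborel) \<partial>lborel)"
  proof (rule nn_integral_cong)
    fix y :: 'a
    have "integrable lborel (\<lambda>x. indicator (cball y \<rho>) x * g x)"
      using integrable_mult_indicator[OF _ g(1), of "cball y \<rho>"] by simp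
    then show "ennreal (LINT x|lborel. indicator (cball y \<rho>) x * g x)
      = (\<integral>\<^sup>+x. ennreal ((if dist y x \<le> \<rho> then 1 else 0) * g x) \<partial>lborel)"
      unfolding ind using g by (intro nn_integral_eq_integral[symmetric]) auto
  qed
  also have "\<dots> = (\<integral>\<^sup>+x. (\<integral>\<^sup>+y. ennreal ((if dist y x \<le> \<rho> then 1 else 0) * g x) \<partial>lborel) \<partial>lborel)"
    by (rule lborel_pair.Fubini'[symmetric]) measurable
  also have "\<dots> = (\<integral>\<^sup>+x. ?V * ennreal (g x) \<partial>lborel)"
  proof (rule nn_integral_cong)
    fix x :: 'a
    have "(\<integral>\<^sup>+y. ennreal ((if dist y x \<le> \<rho> then 1 else 0) * g x) \<partial>lborel)
      = (\<integral>\<^sup>+y. indicator (cball x \<rho>) y * ennreal (g x) \<partial>lborel)"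
      by (intro nn_integral_cong) (auto simp: indicator_def dist_commute)
    also have "\<dots> = ?V * ennreal (g x)"
      by (subst nn_integral_multc) (simp_all add: V[of x] borel_measurable_indicator)
    finally show "(\<integral>\<^sup>+y. ennreal ((if dist y x \<le> \<rho> then 1 else 0) * g x) \<partial>lborel) = ?V * ennreal (g x)" .
  qed
  also have "\<dots> = ?V * (\<integral>\<^sup>+x. ennreal (g x) \<partial>lborel)"
    by (rule nn_integral_cmult) measurable
  also have "(\<integral>\<^sup>+x. ennreal (g x) \<partial>lborel) = ennreal (LINT x|lborel. g x)"
    using g by (intro nn_integral_eq_integral) auto
  also have "?V = ennreal (measure lborel (cball (0::'a) \<rho>))"
  proof (rule emeasure_eq_ennreal_measure)
    show "?V \<noteq> \<top>" using emeasure_bounded_finite[OF bounded_cball, of "0::'a" \<rho>] by auto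
  qed
  also have "\<dots> * ennreal (LINT x|lborel. g x) = ennreal (measure lborel (cball (0::'a) \<rho>) * (LINT x|lborel. g x))"
    using g by (intro ennreal_mult[symmetric] integral_nonneg_AE) auto
  finally show "(\<integral>\<^sup>+y. ennreal (LINT x|lborel. indicator (cball y \<rho>) x * g x) \<partial>lborel)
    = ennreal (measure lborel (cball (0::'a) \<rho>) * (LINT x|lborel. g x))" .
qed

context lipschitz_function
begin

lemma increment_le_averaged_increment:
  assumes P: "bounded P" "P \<in> sets borel" and K: "0 \<le> K" and PC: "P \<subseteq> C"
    and lipC: "\<And>x y. x \<in> C \<Longrightarrow> y \<in> C \<Longrightarrow> \<bar>f x - f y\<bar> \<le> K * norm (x - y)"
    and a: "a \<in> C" "\<And>x. x \<in> P \<Longrightarrow> norm (x - a) \<le> \<rho>"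
    and b: "b \<in> C" "\<And>x. x \<in> P \<Longrightarrow> x + v \<in> C" "\<And>x. x \<in> P \<Longrightarrow> norm (x + v - b) \<le> \<rho>"
  shows "measure lborel P * (\<bar>f b - f a\<bar> - 2 * K * \<rho>) \<le> \<bar>LINT x|lborel. indicator P x * (f (x + v) - f x)\<bar>"
proof -
  define s :: real where "s = (if f a \<le> f b then 1 else - 1)"
  let ?I = "LINT x|lborel. indicator P x * (f (x + v) - f x)"
  have s: "s * (f b - f a) = \<bar>f b - f a\<bar>" "\<bar>s\<bar> = 1" by (auto simp: s_def)
  have int: "integrable lborel (\<lambda>x. indicator P x * (f (x + v) - f x))"
  proof (rule integrable_indicator_mult[OF P])
    show "AE x in lborel. \<bar>f (x + v) - f x\<bar> \<le> L * norm v"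
      using lip_norm[of "x + v" x for x] by simp
  qed measurable
  have intc: "integrable lborel (\<lambda>x. indicator P x * (\<bar>f b - f a\<bar> - 2 * K * \<rho>))"
    by (rule integrable_indicator_mult[OF P, where c = "\<bar>\<bar>f b - f a\<bar> - 2 * K * \<rho>\<bar>"]) auto
  have "measure lborel P * (\<bar>f b - f a\<bar> - 2 * K * \<rho>) = (LINT x|lborel. indicator P x * (\<bar>f b - f a\<bar> - 2 * K * \<rho>))"
    using P by simp
  also have "\<dots> \<le> (LINT x|lborel. s * (indicator P x * (f (x + v) - f x)))"
  proof (rule integral_mono[OF intc integrable_mult_right[OF int]])
    fix x
    show "indicator P x * (\<bar>f b - f a\<bar> - 2 * K * \<rho>) \<le> s * (indicator P x * (f (x + v) - f x))"
    proof (cases "x \<in> P")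
      case True
      have "\<bar>f x - f a\<bar> \<le> K * \<rho>"
        using lipC[of x a] a True PC K by (meson mult_left_mono order_trans subsetD)
      moreover have "\<bar>f (x + v) - f b\<bar> \<le> K * \<rho>"
        using lipC[of "x + v" b] b True K by (meson mult_left_mono order_trans)
      ultimately have "\<bar>f b - f a\<bar> - 2 * (K * \<rho>) \<le> s * (f (x + v) - f x)"
        unfolding s_def by (auto split: if_splits)
      then show ?thesis using True by (simp add: mult.assoc)
    qed simp
  qed
  also have "\<dots> = s * ?I" by simp
  also have "\<dots> \<le> \<bar>s * ?I\<bar>" by (rule abs_ge_self)
  also have "\<dots> = \<bar>?I\<bar>" using s(2) by (simp add: abs_mult)
  finally show ?thesis .
qed

context
  fixes C :: "'a set" and \<Delta> M :: real
  assumes C: "compact C" "convex C" "0 < measure lborel C"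
    and diam: "\<forall>x\<in>C. \<forall>y\<in>C. norm (x - y) \<le> \<Delta>"
    and M: "AE x in lborel. x \<in> C \<longrightarrow> norm (grad x) \<le> M" "0 \<le> M"
begin

text \<open>Average over the copies of \<open>C\<close> shrunk towards \<open>a\<close> and \<open>b\<close>. The error made by averaging is
  controlled by the global Lipschitz constant \<open>L\<close>, possibly much larger than \<open>M\<close>, but it vanishes as
  the copies shrink to points.\<close>

lemma lipschitz_ess_sup:
  assumes ab: "a \<in> C" "b \<in> C"
  shows "\<bar>f b - f a\<bar> \<le> M * norm (b - a)"
proof -
  have D0: "0 \<le> \<Delta>" using diam ab(1) by fastforce
  have key: "\<bar>f b - f a\<bar> \<le> M * norm (b - a) + 2 * L * (e * \<Delta>)" if e: "0 < e" "e \<le> 1" for e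
  proof -
    define P where "P = (\<lambda>c. (1 - e) *\<^sub>R a + e *\<^sub>R c) ` C"
    have e': "0 \<le> e" using e by simp
    note hom = homothety_convex[OF C(1,2) ab(1) e' e(2) diam, folded P_def]
    let ?v = "(1 - e) *\<^sub>R (b - a)"
    have mP: "0 < measure lborel P" using hom(3) C(3) e by simp
    have "measure lborel P * (\<bar>f b - f a\<bar> - 2 * L * (e * \<Delta>))
      \<le> \<bar>LINT x|lborel. indicator P x * (f (x + ?v) - f x)\<bar>"
      by (rule increment_le_averaged_increment[OF hom(1,2) L_nonneg subset_UNIV]) 
        (use lip_norm hom(5) hom(7)[OF _ ab(2)] in auto)
    also have "\<dots> \<le> M * norm ?v * measure lborel P"
      by (rule integral_increment_le_sup[OF hom(1,2) _ _ hom(6)[OF _ ab(2)] M(1)])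
        (use C in \<open>auto intro: compact_imp_bounded borel_compact\<close>)
    finally have "\<bar>f b - f a\<bar> - 2 * L * (e * \<Delta>) \<le> M * norm ?v"
      using mP by (simp add: mult.commute)
    also have "\<dots> \<le> M * norm (b - a)"
      using e M(2) by (intro mult_left_mono) (auto simp: mult_left_le_one_le)
    finally show ?thesis by simp
  qed
  show ?thesis
  proof (rule field_le_epsilon)
    fix \<eta> :: real assume \<eta>: "0 < \<eta>"
    define e where "e = min 1 (\<eta> / (2 * L * \<Delta> + 1))"
    have den: "2 * L * \<Delta> + 1 > 0" using L_nonneg D0 by (simp add: add_nonneg_pos)
    have e: "0 < e" "e \<le> 1" using \<eta> den by (auto simp: e_def)
    have "2 * L * (e * \<Delta>) = e * (2 * L * \<Delta>)" by simp
    also have "\<dots> \<le> \<eta> / (2 * L * \<Delta> + 1) * (2 * L * \<Delta> + 1)"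
      using e L_nonneg D0 \<eta> den by (intro mult_mono) (auto simp: e_def)
    also have "\<dots> = \<eta>" using den by simp
    finally show "\<bar>f b - f a\<bar> \<le> M * norm (b - a) + \<eta>"
      using key[OF e] by linarith
  qed
qed

text \<open>The sliding copy of \<open>C\<close> stays in the ball of radius \<open>r + e * \<Delta>\<close> around \<open>a\<close>, so only the
  gradient there matters. Since \<open>M\<close> is already known to be a Lipschitz constant on \<open>C\<close>, averaging
  costs \<open>2 * M * (e * \<Delta>)\<close>.\<close>

lemma increment_le_local_gradient:
  assumes ab: "a \<in> C" "b \<in> C" "norm (b - a) \<le> r" and e: "0 < e" "e \<le> 1"
  shows "\<bar>f b - f a\<bar> \<le> 2 * M * (e * \<Delta>) + e * \<Delta> / (e ^ DIM('a) * measure lborel C)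
    * (LINT x|lborel. indicator (C \<inter> cball a (r + e * \<Delta>)) x * norm (grad x))"
proof -
  have D0: "0 \<le> \<Delta>" using diam ab(1) by fastforce
  define P where "P = (\<lambda>c. (1 - e) *\<^sub>R a + e *\<^sub>R c) ` C"
  have e': "0 \<le> e" using e by simp
  note hom = homothety_convex[OF C(1,2) ab(1) e' e(2) diam, folded P_def]
  let ?v = "(1 - e) *\<^sub>R (b - a)" and ?Q = "C \<inter> cball a (r + e * \<Delta>)"
  have PC: "P \<subseteq> C" using hom(6)[OF _ ab(2), of _ 0] by auto
  have mP: "0 < measure lborel P" using hom(3) C(3) e by simp
  have "measure lborel P * (\<bar>f b - f a\<bar> - 2 * M * (e * \<Delta>))
    \<le> \<bar>LINT x|lborel. indicator P x * (f (x + ?v) - f x)\<bar>"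
  proof (rule increment_le_averaged_increment[OF hom(1,2) M(2) PC])
    show "\<bar>f x - f y\<bar> \<le> M * norm (x - y)" if "x \<in> C" "y \<in> C" for x y
      using lipschitz_ess_sup that by blast
    show "x + ?v \<in> C" if "x \<in> P" for x using hom(6)[OF that ab(2), of 1] by simp
  qed (use ab hom(5) hom(7)[OF _ ab(2)] in auto)
  also have "\<dots> \<le> e * \<Delta> * (LINT x|lborel. indicator ?Q x * norm (grad x))"
  proof (rule integral_increment_le_gradient[OF hom(1,2) _ _ _ hom(4)])
    show "bounded ?Q" "?Q \<in> sets borel"
      using C by (auto intro: bounded_Int compact_imp_bounded borel_compact sets.Int)
    show "0 \<le> e * \<Delta>" using e D0 by simp
    fix x t assume x: "x \<in> P" and t: "0 \<le> t" "t \<le> (1::real)"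
    have "norm (x + t *\<^sub>R ?v - a) \<le> norm (x - a) + norm (t *\<^sub>R ?v)"
      using norm_triangle_ineq[of "x - a" "t *\<^sub>R ?v"] by (simp add: algebra_simps)
    also have "norm (t *\<^sub>R ?v) = (t * (1 - e)) * norm (b - a)" using t e by simp
    also have "\<dots> \<le> 1 * norm (b - a)"
      using t e by (intro mult_right_mono mult_le_one) auto
    finally have "norm (x + t *\<^sub>R ?v - a) \<le> r + e * \<Delta>"
      using hom(5)[OF x] ab(3) by simp
    then show "x + t *\<^sub>R ?v \<in> ?Q"
      using hom(6)[OF x ab(2) t] by (simp add: dist_norm norm_minus_commute)
  qed
  finally have "\<bar>f b - f a\<bar> - 2 * M * (e * \<Delta>) \<le> e * \<Delta> * (LINT x|lborel. indicator ?Q x * norm (grad x)) / measure lborel P"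
    using mP by (simp add: le_divide_eq mult.commute)
  then show ?thesis by (simp add: hom(3))
qed

end

end

section \<open>The unit cube, the empirical measure and the gradient norms\<close>

lemma measure_unit_cube: "measure lborel (unit_cube :: (real ^ 'n) set) = 1"
proof -
  have "emeasure lborel (unit_cube :: (real ^ 'n) set) = emeasure cube_measure (space (cube_measure :: (real ^ 'n) measure))"
    by (simp add: cube_measure_def space_restrict_space emeasure_restrict_space)
  also have "\<dots> = 1" using prob_space_cube_measure by (rule prob_space.emeasure_space_1)
  finally show ?thesis by (simp add: measure_def)
qed

lemma unit_cube_diameter:
  assumes "x \<in> unit_cube" "y \<in> (unit_cube :: (real ^ 'n) set)"
  shows "norm (x - y) \<le> real CARD('n)"
proof -
  have "norm (x - y) \<le> (\<Sum>i\<in>UNIV. \<bar>(x - y) $ i\<bar>)" by (rule norm_le_l1_cart)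
  also have "\<dots> \<le> (\<Sum>i\<in>(UNIV :: 'n set). 1)"
  proof (rule sum_mono)
    fix i :: 'n
    have "0 \<le> x $ i" "x $ i \<le> 1" "0 \<le> y $ i" "y $ i \<le> 1"
      using assms by (auto simp: mem_box_cart)
    then show "\<bar>(x - y) $ i\<bar> \<le> 1" by simp
  qed
  finally show ?thesis by simp
qed

lemma empirical_measure_eq_distr:
  fixes x :: "nat \<Rightarrow> real ^ 'n"
  assumes "N \<ge> 1" "\<forall>k\<in>{1..N}. x k \<in> unit_cube"
  shows "empirical_measure N x = distr (uniform_count_measure {1..N}) (restrict_space borel unit_cube) x"
proof (rule measure_eqI)
  let ?B = "restrict_space borel (unit_cube :: (real ^ 'n) set)"
  have x: "x \<in> measurable (uniform_count_measure {1..N}) ?B"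
    using assms(2) by (simp add: uniform_count_measure_def measurable_point_measure_eq1 space_restrict_space)
  show "sets (empirical_measure N x) = sets (distr (uniform_count_measure {1..N}) ?B x)" by simp
  fix A assume "A \<in> sets (empirical_measure N x)"
  then have A: "A \<in> sets ?B" by simp
  have "emeasure (empirical_measure N x) A = (\<Sum>k=1..N. indicator A (x k)) / of_nat N"
    using A by (simp add: emeasure_empirical_measure)
  also have "(\<Sum>k=1..N. indicator A (x k)) = (of_nat (card {k\<in>{1..N}. x k \<in> A}) :: ennreal)"
  proof -
    have "(\<Sum>k=1..N. indicator A (x k)) = (\<Sum>k\<in>{k\<in>{1..N}. x k \<in> A}. 1 :: ennreal)"
      by (rule sum.mono_neutral_cong_right) auto
    then show ?thesis by simp
  qed
  also have "of_nat (card {k\<in>{1..N}. x k \<in> A}) / of_nat N = ennreal (card {k\<in>{1..N}. x k \<in> A} / N)"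
    using assms(1) by (simp add: ennreal_of_nat_eq_real_of_nat divide_ennreal)
  also have "{k\<in>{1..N}. x k \<in> A} = x -` A \<inter> space (uniform_count_measure {1..N})"
    by (auto simp: space_uniform_count_measure)
  also have "ennreal (card (x -` A \<inter> space (uniform_count_measure {1..N})) / N)
    = emeasure (distr (uniform_count_measure {1..N}) ?B x) A"
    using x A by (simp add: emeasure_distr emeasure_uniform_count_measure space_uniform_count_measure)
  finally show "emeasure (empirical_measure N x) A = emeasure (distr (uniform_count_measure {1..N}) ?B x) A" .
qed

text \<open>The choice \<open>\<delta> = (A / M) powr (1 / d)\<close> makes both terms equal to \<open>M * \<delta>\<close> up to constants. If \<open>A\<close>
  vanishes, \<open>\<delta>\<close> tends to \<open>0\<close> instead.\<close>

lemma optimise_scale: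
  fixes E r M A K :: real and d :: nat
  assumes E: "\<And>\<delta>. 0 < \<delta> \<Longrightarrow> \<delta> \<le> 1 \<Longrightarrow> E \<le> r * (2 * M * \<delta> + K * A * (\<delta> / \<delta> ^ d))"
    and nn: "0 \<le> A" "A \<le> M" "0 \<le> r" "0 \<le> K" "1 \<le> d"
  shows "E \<le> (2 + K) * M powr ((real d - 1) / real d) * A powr (1 / real d) * r"
proof (cases "A = 0")
  case True
  have "E \<le> 0"
  proof (rule field_le_epsilon)
    fix e :: real assume e: "0 < e"
    define \<delta> where "\<delta> = min 1 (e / (2 * r * M + 1))"
    have M: "0 \<le> 2 * r * M" using nn by simp
    then have den: "0 < 2 * r * M + 1" by linarith
    have \<delta>: "0 < \<delta>" "\<delta> \<le> 1" using e den by (auto simp: \<delta>_def)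
    have "E \<le> \<delta> * (2 * r * M)" using E[OF \<delta>] by (simp add: True mult_ac)
    also have "\<dots> \<le> e / (2 * r * M + 1) * (2 * r * M + 1)"
      using M e den by (intro mult_mono) (auto simp: \<delta>_def)
    also have "\<dots> = e" using den by simp
    finally show "E \<le> 0 + e" by simp
  qed
  then show ?thesis by (simp add: True)
next
  case False
  then have A: "0 < A" and M: "0 < M" using nn by auto
  define \<delta> where "\<delta> = (A / M) powr (1 / real d)"
  have \<delta>: "0 < \<delta>" "\<delta> \<le> 1"
    using A M nn by (auto simp: \<delta>_def intro!: powr_le1)
  have \<delta>d: "\<delta> ^ d = A / M"
    using A M nn by (simp add: \<delta>_def powr_powr flip: powr_realpow)
  have M\<delta>: "M * \<delta> = M powr ((real d - 1) / real d) * A powr (1 / real d)"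
  proof -
    have "M * \<delta> = M powr 1 * (A powr (1 / real d) / M powr (1 / real d))"
      using A M by (simp add: \<delta>_def powr_divide)
    also have "\<dots> = M powr (1 - 1 / real d) * A powr (1 / real d)"
      by (simp only: powr_diff times_divide_eq_right times_divide_eq_left mult.commute)
    also have "1 - 1 / real d = (real d - 1) / real d" using nn by (simp add: field_simps)
    finally show ?thesis .
  qed
  have "E \<le> r * (2 * M * \<delta> + K * A * (\<delta> / \<delta> ^ d))" using E[OF \<delta>] .
  also have "\<dots> = (2 + K) * (M * \<delta>) * r" using A M by (simp add: \<delta>d field_simps)
  finally show ?thesis by (simp add: M\<delta> mult.assoc)
qed

lemma gradient_on_eq:
  assumes int: "x \<in> interior S" and f: "(F has_derivative (\<lambda>h. h \<bullet> g)) (at x)" and eq: "\<And>y. y \<in> S \<Longrightarrow> F y = f y"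
  shows "gradient_on S f x = (g :: 'a::euclidean_space)"
proof -
  have x: "x \<in> S" using int interior_subset by blast
  have at: "at x within S = at x" using int by (rule at_within_interior)
  have f': "(f has_derivative (\<lambda>h. h \<bullet> g)) (at x within S)"
  proof (rule has_derivative_transform[OF x])
    show "f y = F y" if "y \<in> S" for y using eq[OF that] by simp
    show "(F has_derivative (\<lambda>h. h \<bullet> g)) (at x within S)"
      using f by (rule has_derivative_at_withinI)
  qed
  have "D = g" if "(f has_derivative (\<lambda>h. h \<bullet> D)) (at x within S)" for D
  proof -
    have D: "(f has_derivative (\<lambda>h. h \<bullet> D)) (at x)" using that by (simp only: at)
    have g: "(f has_derivative (\<lambda>h. h \<bullet> g)) (at x)" using f' by (simp only: at)
    have "\<forall>h. h \<bullet> D = h \<bullet> g"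
      using has_derivative_unique[OF D g] by (simp add: fun_eq_iff)
    then show ?thesis by (simp only: vector_eq_ldot)
  qed
  then have "(SOME D. (f has_derivative (\<lambda>h. h \<bullet> D)) (at x within S)) = g"
    by (rule some_equality[where P = "\<lambda>D. (f has_derivative (\<lambda>h. h \<bullet> D)) (at x within S)", OF f'])
  moreover have "\<exists>D. (f has_derivative (\<lambda>h. h \<bullet> D)) (at x within S)" using f' by (rule exI)
  ultimately show ?thesis by (simp only: gradient_on_def if_True)
qed

text \<open>A function on the cube together with a Lipschitz extension to the whole space, to which
  the translation arguments apply.\<close>

locale lipschitz_on_cube = lipschitz_function F L for F :: "real ^ 'n \<Rightarrow> real" and L +
  fixes f :: "real ^ 'n \<Rightarrow> real"
  assumes F_eq: "\<And>y. y \<in> unit_cube \<Longrightarrow> F y = f y"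
begin

lemma AE_gradient_on_cube:
  "AE y in lborel. y \<in> unit_cube \<longrightarrow> gradient_on unit_cube f y = grad y"
proof -
  have "cbox 0 1 - box 0 (1 :: real ^ 'n) \<in> null_sets lborel"
    using negligible_frontier_interval[of 0 "1 :: real ^ 'n"] by (simp add: negligible_iff_null_sets null_sets_completion_iff)
  then have "AE y in lborel. y \<notin> cbox 0 1 - box 0 (1 :: real ^ 'n)" by (rule AE_not_in)
  then show ?thesis
    using rademacher
  proof eventually_elim
    case (elim y)
    show ?case
    proof
      assume "y \<in> unit_cube"
      then have "y \<in> interior unit_cube" using elim(1) by simp
      then show "gradient_on unit_cube f y = grad y"
        using elim(2) F_eq by (rule gradient_on_eq)
    qed
  qed
qed

lemma measurable_gradient_on_cube:
  "(\<lambda>y. indicator unit_cube y *\<^sub>R norm (gradient_on unit_cube f y)) \<in> borel_measurable lebesgue"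
proof (rule borel_measurable_AE)
  show "(\<lambda>y. indicator unit_cube y * norm (grad y)) \<in> borel_measurable lebesgue"
    by (rule measurable_completion) measurable
  have "AE y in lebesgue. y \<in> unit_cube \<longrightarrow> gradient_on unit_cube f y = grad y"
    using AE_gradient_on_cube by (rule AE_completion)
  then show "AE y in lebesgue. indicator unit_cube y * norm (grad y)
      = indicator unit_cube y *\<^sub>R norm (gradient_on unit_cube f y)"
    by eventually_elim (auto simp: indicator_def)
qed

definition gradL1 where "gradL1 = (LINT y|lborel. indicator unit_cube y * norm (grad y))"

definition gradLinf where "gradLinf = Linf_norm (lebesgue_on unit_cube) (\<lambda>y. norm (gradient_on unit_cube f y))"

lemma L1_norm_gradient:
  "L1_norm (lebesgue_on unit_cube) (\<lambda>y. norm (gradient_on unit_cube f y)) = gradL1"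
proof -
  have "L1_norm (lebesgue_on unit_cube) (\<lambda>y. norm (gradient_on unit_cube f y))
    = (LINT y|lebesgue. indicator unit_cube y *\<^sub>R norm (gradient_on unit_cube f y))"
    unfolding L1_norm_def by (subst integral_restrict_space) simp_all
  also have "\<dots> = (LINT y|lebesgue. indicator unit_cube y * norm (grad y))"
  proof (rule Bochner_Integration.integral_cong_AE[OF measurable_gradient_on_cube])
    show "(\<lambda>y. indicator unit_cube y * norm (grad y)) \<in> borel_measurable lebesgue"
      by (rule measurable_completion) measurable
    show "AE y in lebesgue. indicator unit_cube y *\<^sub>R norm (gradient_on unit_cube f y) = indicator unit_cube y * norm (grad y)"
      using AE_completion[OF AE_gradient_on_cube] by eventually_elim (auto simp: indicator_def)
  qed
  also have "\<dots> = gradL1"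
    unfolding gradL1_def by (rule integral_completion) measurable
  finally show ?thesis .
qed

lemma gradLinf_nonneg: "0 \<le> gradLinf"
  by (simp add: gradLinf_def Linf_norm_def)

lemma AE_grad_le_gradLinf: "AE y in lborel. y \<in> unit_cube \<longrightarrow> norm (grad y) \<le> gradLinf"
proof -
  let ?\<nu> = "lebesgue_on (unit_cube :: (real ^ 'n) set)"
  let ?g = "\<lambda>y. ennreal \<bar>norm (gradient_on unit_cube f y)\<bar>"
  obtain B where B: "AE y in lborel. norm (grad y) \<le> B"
    using AE_grad_bound by blast
  have cube: "unit_cube \<inter> space lebesgue \<in> sets (lebesgue :: (real ^ 'n) measure)" by simp
  have AE\<nu>: "(AE y in ?\<nu>. P y) \<longleftrightarrow> (AE y in lborel. y \<in> unit_cube \<longrightarrow> P y)" for P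
    unfolding AE_restrict_space_iff[OF cube] AE_completion_iff ..
  have "(\<lambda>y. norm (gradient_on unit_cube f y)) \<in> borel_measurable ?\<nu>"
    using measurable_gradient_on_cube by (simp add: borel_measurable_restrict_space_iff)
  then have meas: "?g \<in> borel_measurable ?\<nu>" by measurable
  have "AE y in ?\<nu>. ?g y \<le> ennreal B"
    unfolding AE\<nu> using AE_gradient_on_cube B by eventually_elim (auto intro: ennreal_leI)
  then have "esssup ?\<nu> ?g \<le> ennreal B" by (rule esssup_I[OF meas])
  then have "esssup ?\<nu> ?g < top" using le_less_trans[OF _ ennreal_less_top] by blast
  then have top: "ennreal gradLinf = esssup ?\<nu> ?g" by (simp add: gradLinf_def Linf_norm_def)
  have "AE y in ?\<nu>. ?g y \<le> esssup ?\<nu> ?g" by (rule esssup_AE)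
  then show ?thesis
    unfolding AE\<nu> top[symmetric] using AE_gradient_on_cube
    by eventually_elim (use gradLinf_nonneg in \<open>auto simp: ennreal_le_iff\<close>)
qed

lemma gradL1_bounds: "0 \<le> gradL1" "gradL1 \<le> gradLinf"
proof -
  show "0 \<le> gradL1" unfolding gradL1_def by (intro integral_nonneg_AE) auto
  have "gradL1 \<le> (LINT y|(lborel :: (real ^ 'n) measure). indicator unit_cube y * gradLinf)"
    unfolding gradL1_def
  proof (rule integral_mono_AE)
    show "integrable lborel (\<lambda>y. indicator unit_cube y * norm (grad y))"
      by (rule integrable_indicator_grad) auto
    show "integrable lborel (\<lambda>y::real^'n. indicator unit_cube y * gradLinf)"
      by (rule integrable_indicator_mult[where c = "\<bar>gradLinf\<bar>"]) auto
    show "AE y in lborel. indicator unit_cube y * norm (grad y) \<le> indicator unit_cube y * gradLinf"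
      using AE_grad_le_gradLinf by eventually_elim (auto simp: indicator_def)
  qed
  also have "\<dots> = gradLinf" using measure_unit_cube[where 'n='n] by simp
  finally show "gradL1 \<le> gradLinf" .
qed

section \<open>Transport at bounded distance\<close>

text \<open>The volume of a ball of radius \<open>2 * r\<close> over that of a cube scaled by \<open>r / CARD('n)\<close>, where
  \<open>CARD('n)\<close> serves as a bound for the diameter of the unit cube.\<close>

definition transport_const :: real where "transport_const = real CARD('n) ^ CARD('n) * 2 ^ CARD('n) * unit_ball_vol (real CARD('n))"

text \<open>For \<open>\<pi>\<close>-almost all pairs the increment is bounded by a function of the first coordinate alone,
  whose distribution is Lebesgue measure on the cube.\<close>

lemma transport_bound_scale:
  fixes \<nu> :: "(real ^ 'n) measure"
  assumes \<pi>: "\<pi> \<in> couplings cube_measure \<nu>" and \<nu>: "sets \<nu> = sets (restrict_space borel unit_cube)"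
    and r: "0 < r" "AE p in \<pi>. norm (fst p - snd p) \<le> r" and \<delta>: "0 < \<delta>" "\<delta> \<le> 1"
  shows "\<bar>(LINT y|cube_measure. F y) - (LINT z|\<nu>. F z)\<bar>
    \<le> r * (2 * gradLinf * \<delta> + transport_const * gradL1 * (\<delta> / \<delta> ^ CARD('n)))"
proof -
  let ?C = "unit_cube :: (real ^ 'n) set"
  let ?\<mu> = "cube_measure :: (real ^ 'n) measure"
  define \<Delta> where "\<Delta> = real CARD('n)"
  have \<Delta>: "0 < \<Delta>" by (simp add: \<Delta>_def)
  \<comment> \<open>distances in the cube are at most \<open>\<Delta>\<close>; capping
    \<open>r\<close> keeps the scale \<open>e\<close> of the shrunken cube below
    \<open>1\<close>\<close>
  define r' where "r' = min r \<Delta>"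
  have r': "0 < r'" "r' \<le> r" "r' \<le> \<Delta>" using r \<Delta> by (auto simp: r'_def)
  define e where "e = \<delta> * r' / \<Delta>"
  have e\<Delta>: "e * \<Delta> = \<delta> * r'" using \<Delta> by (simp add: e_def)
  have "\<delta> * r' \<le> 1 * \<Delta>" using \<delta> r' by (intro mult_mono) auto
  then have e: "0 < e" "e \<le> 1" using \<delta> r' \<Delta> by (auto simp: e_def divide_le_eq)
  define g where "g y = indicator ?C y * norm (grad y)" for y
  have g: "integrable lborel g" "0 \<le> g y" for y
    unfolding g_def by (auto intro: integrable_indicator_grad)
  define H where "H y = (LINT x|lborel. indicator (cball y (2 * r')) x * g x)" for y
  have H: "integrable lborel H" "(LINT y|lborel. H y) = measure lborel (cball (0 :: real ^ 'n) (2 * r')) * gradL1"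
  proof -
    have "(LINT y|lborel. g y) = gradL1" by (simp add: gradL1_def g_def)
    then have "has_bochner_integral lborel H (measure lborel (cball (0 :: real ^ 'n) (2 * r')) * gradL1)"
      using has_bochner_integral_ball_average[OF g, of "2 * r'"] unfolding H_def[abs_def] by (simp only:)
    then show "integrable lborel H" "(LINT y|lborel. H y) = measure lborel (cball (0 :: real ^ 'n) (2 * r')) * gradL1"
      unfolding has_bochner_integral_iff by blast+
  qed
  have [measurable]: "H \<in> borel_measurable borel" using H(1) by (simp add: borel_measurable_integrable)
  have H0: "0 \<le> H y" for y unfolding H_def using g by (intro integral_nonneg_AE) auto
  define c where "c = e * \<Delta> / e ^ CARD('n)"
  have c: "0 \<le> c" using e \<Delta> by (simp add: c_def)
  have incr: "\<bar>F y - F z\<bar> \<le> 2 * gradLinf * (\<delta> * r') + c * H y"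
    if yz: "y \<in> ?C" "z \<in> ?C" "norm (y - z) \<le> r" for y z
  proof -
    have "norm (z - y) \<le> r'"
      using unit_cube_diameter[OF yz(2,1)] yz(3) by (simp add: r'_def \<Delta>_def norm_minus_commute)
    then have "\<bar>F z - F y\<bar> \<le> 2 * gradLinf * (e * \<Delta>) + e * \<Delta> / (e ^ DIM(real ^ 'n) * measure lborel ?C)
      * (LINT x|lborel. indicator (?C \<inter> cball y (r' + e * \<Delta>)) x * norm (grad x))"
      using AE_grad_le_gradLinf gradLinf_nonneg measure_unit_cube[where 'n='n] unit_cube_diameter e yz
      by (intro increment_le_local_gradient) (auto simp: \<Delta>_def)
    also have "e * \<Delta> / (e ^ DIM(real ^ 'n) * measure lborel ?C) = c"
      unfolding measure_unit_cube by (simp add: c_def)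
    also have "(LINT x|lborel. indicator (?C \<inter> cball y (r' + e * \<Delta>)) x * norm (grad x)) \<le> H y"
      unfolding H_def
    proof (rule integral_mono)
      show "integrable lborel (\<lambda>x. indicator (?C \<inter> cball y (r' + e * \<Delta>)) x * norm (grad x))"
        by (rule integrable_indicator_grad) (auto intro: bounded_Int)
      show "integrable lborel (\<lambda>x. indicator (cball y (2 * r')) x * g x)"
        using integrable_mult_indicator[OF _ g(1), of "cball y (2 * r')"] by simp
      have "r' + e * \<Delta> \<le> 2 * r'" unfolding e\<Delta> using \<delta> r' by (simp add: mult_left_le_one_le)
      then show "indicator (?C \<inter> cball y (r' + e * \<Delta>)) x * norm (grad x)
          \<le> indicator (cball y (2 * r')) x * g x" for x
        by (auto simp: g_def indicator_def)
    qed
    finally show ?thesis using c by (simp add: e\<Delta> abs_minus_commute mult_left_mono)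
  qed
  have sets: "sets \<pi> = sets (?\<mu> \<Otimes>\<^sub>M \<nu>)" and fst: "distr \<pi> ?\<mu> fst = ?\<mu>" and snd: "distr \<pi> \<nu> snd = \<nu>"
    using \<pi> by (auto simp: couplings_def)
  have space\<nu>: "space \<nu> = ?C" using sets_eq_imp_space_eq[OF \<nu>] by (simp add: space_restrict_space)
  have space: "space \<pi> = ?C \<times> ?C"
    using sets_eq_imp_space_eq[OF sets] by (simp add: space_pair_measure space\<nu>)
  have mf: "fst \<in> measurable \<pi> ?\<mu>" and ms: "snd \<in> measurable \<pi> \<nu>"
    by (auto simp: measurable_cong_sets[OF sets refl])
  have meas\<mu>: "h \<in> borel_measurable ?\<mu>" and meas\<nu>: "h \<in> borel_measurable \<nu>" if "h \<in> borel_measurable borel" for h :: "real ^ 'n \<Rightarrow> real"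
    using measurable_restrict_space1[OF that, of ?C] 
    by (auto simp: measurable_cong_sets[OF sets_cube_measure refl] measurable_cong_sets[OF \<nu> refl])
  interpret \<mu>: prob_space ?\<mu> by (rule prob_space_cube_measure)
  interpret \<pi>: prob_space \<pi>
    using prob_space_distrD[OF mf] prob_space_cube_measure[where 'n='n] by (simp add: fst)
  obtain B where B: "\<And>y. y \<in> ?C \<Longrightarrow> \<bar>F y\<bar> \<le> B"
    using compact_imp_bounded[OF compact_continuous_image[OF continuous_f compact_cbox]] unfolding bounded_iff
    by (metis image_eqI real_norm_def)
  have i1: "integrable \<pi> (\<lambda>p. F (fst p))"
    using measurable_compose[OF mf meas\<mu>[OF borel_f]]
    by (intro \<pi>.integrable_const_bound[where B = B]) (auto simp: space intro!: AE_I2 B)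
  have i2: "integrable \<pi> (\<lambda>p. F (snd p))"
    using measurable_compose[OF ms meas\<nu>[OF borel_f]]
    by (intro \<pi>.integrable_const_bound[where B = B]) (auto simp: space intro!: AE_I2 B)
  let ?h = "\<lambda>y. 2 * gradLinf * (\<delta> * r') + c * H y"
  have IH: "integrable ?\<mu> H" "(LINT y|?\<mu>. H y) = (LINT y|lborel. indicator ?C y * H y)"
    unfolding cube_measure_def using H(1) integrable_mult_indicator[OF _ H(1), of ?C]
    by (simp_all add: integrable_restrict_space integral_restrict_space)
  have "\<bar>(LINT y|?\<mu>. F y) - (LINT z|\<nu>. F z)\<bar> = \<bar>(LINT p|\<pi>. F (fst p)) - (LINT p|\<pi>. F (snd p))\<bar>"
    using integral_distr[OF mf meas\<mu>[OF borel_f]] integral_distr[OF ms meas\<nu>[OF borel_f]] by (simp add: fst snd)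
  also have "\<dots> = \<bar>LINT p|\<pi>. F (fst p) - F (snd p)\<bar>"
    using i1 i2 by simp
  also have "\<dots> \<le> (LINT p|\<pi>. \<bar>F (fst p) - F (snd p)\<bar>)"
    by (rule integral_abs_bound)
  also have "\<dots> \<le> (LINT p|\<pi>. ?h (fst p))"
  proof (rule integral_mono_AE)
    show "integrable \<pi> (\<lambda>p. \<bar>F (fst p) - F (snd p)\<bar>)" using i1 i2 by simp
    have "integrable (distr \<pi> ?\<mu> fst) ?h" unfolding fst using IH(1) by simp
    then show "integrable \<pi> (\<lambda>p. ?h (fst p))" by (rule integrable_distr[OF mf])
    show "AE p in \<pi>. \<bar>F (fst p) - F (snd p)\<bar> \<le> ?h (fst p)"
      using r(2) AE_space by eventually_elim (auto simp: space intro!: incr)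
  qed
  also have "\<dots> = (LINT y|?\<mu>. ?h y)"
    using integral_distr[OF mf meas\<mu>, of ?h] by (simp add: fst)
  also have "\<dots> = 2 * gradLinf * (\<delta> * r') + c * (LINT y|lborel. indicator ?C y * H y)"
    using IH \<mu>.prob_space by simp
  finally have avg: "\<bar>(LINT y|?\<mu>. F y) - (LINT z|\<nu>. F z)\<bar>
    \<le> 2 * gradLinf * (\<delta> * r') + c * (LINT y|lborel. indicator ?C y * H y)" .
  have "(LINT y|lborel. indicator ?C y * H y) \<le> (LINT y|lborel. H y)"
    using H(1) H0 integrable_mult_indicator[OF _ H(1), of ?C]
    by (intro integral_mono) (auto simp: indicator_def)
  also have "(LINT y|lborel. H y) = unit_ball_vol (real CARD('n)) * (2 * r') ^ CARD('n) * gradL1"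
    unfolding H(2) using r' by (simp add: content_cball)
  finally have "c * (LINT y|lborel. indicator ?C y * H y)
      \<le> c * (unit_ball_vol (real CARD('n)) * (2 * r') ^ CARD('n) * gradL1)"
    using c by (rule mult_left_mono)
  also have "\<dots> = r' * (transport_const * gradL1 * (\<delta> / \<delta> ^ CARD('n)))"
    unfolding c_def e\<Delta> transport_const_def using r' \<delta> \<Delta>
    by (simp add: e_def \<Delta>_def[symmetric] power_divide power_mult_distrib field_simps)
  finally have "c * (LINT y|lborel. indicator ?C y * H y) \<le> r' * (transport_const * gradL1 * (\<delta> / \<delta> ^ CARD('n)))" .
  then have "\<bar>(LINT y|?\<mu>. F y) - (LINT z|\<nu>. F z)\<bar> \<le> r' * (2 * gradLinf * \<delta> + transport_const * gradL1 * (\<delta> / \<delta> ^ CARD('n)))"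
    using avg by (simp add: distrib_left mult_ac)
  also have "\<dots> \<le> r * (2 * gradLinf * \<delta> + transport_const * gradL1 * (\<delta> / \<delta> ^ CARD('n)))"
    using r' \<delta> gradLinf_nonneg gradL1_bounds by (intro mult_right_mono) (auto simp: transport_const_def)
  finally show ?thesis .
qed

end

text \<open>The second coordinate is almost surely one of the points, so the first lies within \<open>r\<close> of one.\<close>

lemma coupling_lower_bound:
  fixes x :: "nat \<Rightarrow> real ^ 'n"
  assumes N: "N \<ge> 1" "\<forall>k\<in>{1..N}. x k \<in> unit_cube"
    and \<pi>: "\<pi> \<in> couplings cube_measure (empirical_measure N x)"
    and r: "0 < r" "AE p in \<pi>. norm (fst p - snd p) \<le> r"
  shows "1 \<le> real N * (unit_ball_vol (real CARD('n)) * r ^ CARD('n))"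
proof -
  let ?C = "unit_cube :: (real ^ 'n) set"
  let ?\<mu> = "cube_measure :: (real ^ 'n) measure"
  let ?\<nu> = "empirical_measure N x"
  let ?U = "\<Union>k\<in>{1..N}. cball (x k) r"
  have sets: "sets \<pi> = sets (?\<mu> \<Otimes>\<^sub>M ?\<nu>)" and fst: "distr \<pi> ?\<mu> fst = ?\<mu>" and snd: "distr \<pi> ?\<nu> snd = ?\<nu>"
    using \<pi> by (auto simp: couplings_def)
  have mf: "fst \<in> measurable \<pi> ?\<mu>" and ms: "snd \<in> measurable \<pi> ?\<nu>"
    by (auto simp: measurable_cong_sets[OF sets refl])
  have "x \<in> measurable (uniform_count_measure {1..N}) (restrict_space borel ?C)"
    using N(2) by (simp add: uniform_count_measure_def measurable_point_measure_eq1 space_restrict_space)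
  moreover have fin: "finite (x ` {1..N})" by simp
  have "x ` {1..N} = (x ` {1..N}) \<inter> ?C" using N(2) by auto
  then have pts: "x ` {1..N} \<in> sets (restrict_space borel ?C)"
    by (metis (no_types, lifting) borel_closed closed_cbox finite_imp_closed fin inf_le2 sets_restrict_space_iff sets.Int Int_absorb1 space_borel inf_top_right)
  ultimately have "AE z in distr (uniform_count_measure {1..N}) (restrict_space borel ?C) x. z \<in> x ` {1..N}"
    using sets.sets_into_space[OF pts]
    by (subst AE_distr_iff) (auto intro!: AE_I2 simp: space_uniform_count_measure Collect_conj_eq Int_absorb1)
  then have "AE z in ?\<nu>. z \<in> x ` {1..N}" by (simp only: empirical_measure_eq_distr[OF N])
  then have "AE z in distr \<pi> ?\<nu> snd. z \<in> x ` {1..N}" by (simp only: snd)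
  then have "AE p in \<pi>. snd p \<in> x ` {1..N}" by (rule AE_distrD[OF ms])
  then have near: "AE p in \<pi>. fst p \<in> ?U"
    using r(2) by eventually_elim (force simp: dist_norm norm_minus_commute)
  have "?U \<in> sets borel" by (intro sets.finite_UN) auto
  then have U: "?U \<inter> ?C \<in> sets ?\<mu>"
    unfolding sets_cube_measure sets_restrict_space by (intro image_eqI[of _ _ ?U]) (simp_all only: Int_commute)
  have "{y \<in> space ?\<mu>. y \<in> ?U} = ?U \<inter> ?C"
    unfolding space_cube_measure by blast
  with U have "{y \<in> space ?\<mu>. y \<in> ?U} \<in> sets ?\<mu>" by (simp only:)
  then have "AE y in distr \<pi> ?\<mu> fst. y \<in> ?U"
    using near by (rule AE_distr_iff[OF mf, THEN iffD2])
  then have AE: "AE y in ?\<mu>. y \<in> ?U \<inter> ?C" unfolding fst using AE_space by eventually_elim simp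
  interpret \<mu>: prob_space ?\<mu> by (rule prob_space_cube_measure)
  have "1 = measure ?\<mu> (?U \<inter> ?C)"
    using \<mu>.AE_in_set_eq_1[OF U] AE by simp
  also have "\<dots> = measure lborel (?U \<inter> ?C)"
    unfolding cube_measure_def by (rule measure_restrict_space) auto
  also have "\<dots> \<le> measure lborel ?U"
  proof (rule measure_mono_fmeasurable)
    have "bounded ?U" by (intro bounded_UN) auto
    then show "?U \<in> fmeasurable lborel"
      by (intro fmeasurableI emeasure_bounded_finite) auto
  qed auto
  also have "\<dots> \<le> (\<Sum>k\<in>{1..N}. measure lborel (cball (x k) r))"
    by (rule measure_UNION_le) auto
  also have "\<dots> = real N * (unit_ball_vol (real CARD('n)) * r ^ CARD('n))"
    using r by (simp add: content_cball)
  finally show ?thesis .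
qed

section \<open>The integration error\<close>

theorem mainTheorem1:
  shows "\<exists>c::real. c > 0 \<and>
    (\<forall>N::nat. \<forall>x::nat \<Rightarrow> real ^ 'n. \<forall>f::real ^ 'n \<Rightarrow> real.
      N \<ge> 1 \<longrightarrow>
      (\<forall>k\<in>{1..N}. x k \<in> unit_cube) \<longrightarrow>
      (\<exists>L. L-lipschitz_on unit_cube f) \<longrightarrow>
      \<bar>(LINT y|cube_measure. f y) - (\<Sum>k=1..N. f (x k)) / real N\<bar>
      \<le> c
        * Linf_norm (lebesgue_on unit_cube) (\<lambda>y. norm (gradient_on unit_cube f y))
            powr ((real CARD('n) - 1) / real CARD('n))
        * L1_norm (lebesgue_on unit_cube) (\<lambda>y. norm (gradient_on unit_cube f y))
            powr (1 / real CARD('n))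
        * real N powr (1 / real CARD('n))
        * (enn2real (W_inf cube_measure (empirical_measure N x)))\<^sup>2)"
proof -
  let ?d = "CARD('n)"
  let ?C = "unit_cube :: (real ^ 'n) set"
  define \<omega> where "\<omega> = unit_ball_vol (real ?d)"
  have \<omega>: "0 < \<omega>" by (simp add: \<omega>_def)
  define K where "K = real ?d ^ ?d * 2 ^ ?d * \<omega>"
  have K: "0 \<le> K" using \<omega> by (simp add: K_def)
  define c where "c = (2 + K) * \<omega> powr (1 / real ?d)"
  have "c > 0" using K \<omega> by (simp add: c_def)
  moreover have "\<bar>(LINT y|cube_measure. f y) - (\<Sum>k=1..N. f (x k)) / real N\<bar>
      \<le> c
        * Linf_norm (lebesgue_on ?C) (\<lambda>y. norm (gradient_on ?C f y))
            powr ((real ?d - 1) / real ?d)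
        * L1_norm (lebesgue_on ?C) (\<lambda>y. norm (gradient_on ?C f y))
            powr (1 / real ?d)
        * real N powr (1 / real ?d)
        * (enn2real (W_inf cube_measure (empirical_measure N x)))\<^sup>2"
    if N: "N \<ge> 1" "\<forall>k\<in>{1..N}. x k \<in> ?C" and L: "L-lipschitz_on ?C f" for N x f L
  proof -
    \<comment> \<open>projecting to the cube extends \<open>f\<close> with the same Lipschitz
      constant\<close>
    define F where "F = f \<circ> closest_point ?C"
    have ne: "?C \<noteq> {}" using N by auto
    have "1-lipschitz_on UNIV (closest_point ?C)"
      using closest_point_lipschitz[OF convex_box(1) closed_cbox ne] by (intro lipschitz_onI) auto
    moreover have "closest_point ?C ` UNIV \<subseteq> ?C"
      using closest_point_in_set[OF closed_cbox ne] by auto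
    ultimately have "(L * 1)-lipschitz_on UNIV F"
      unfolding F_def using L by (intro lipschitz_on_compose lipschitz_on_subset[OF L])
    then interpret lipschitz_on_cube F L f
      by unfold_locales (auto simp: F_def closest_point_self)
    let ?\<nu> = "empirical_measure N x"
    define W where "W = enn2real (W_inf cube_measure ?\<nu>)"
    have W: "0 \<le> W" "W_inf cube_measure ?\<nu> = ennreal W"
      using W_inf_cube_finite[OF N] by (auto simp: W_def less_top)
    define E where "E = \<bar>(LINT y|cube_measure. f y) - (\<Sum>k=1..N. f (x k)) / real N\<bar>"
    have If: "(LINT y|cube_measure. f y) = (LINT y|cube_measure. F y)"
      by (rule Bochner_Integration.integral_cong) (auto simp: F_eq)
    have I\<nu>: "(\<Sum>k=1..N. f (x k)) / real N = (LINT z|?\<nu>. F z)"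
    proof -
      let ?B = "restrict_space borel ?C"
      have "x \<in> measurable (uniform_count_measure {1..N}) ?B"
        using N(2) by (simp add: uniform_count_measure_def measurable_point_measure_eq1 space_restrict_space)
      then have "(LINT z|?\<nu>. F z) = (LINT k|uniform_count_measure {1..N}. F (x k))"
        unfolding empirical_measure_eq_distr[OF N] by (rule integral_distr) (rule measurable_restrict_space1[OF borel_f])
      also have "\<dots> = (\<Sum>k=1..N. F (x k)) / real N"
        by (subst integral_uniform_count_measure) auto
      also have "(\<Sum>k=1..N. F (x k)) = (\<Sum>k=1..N. f (x k))"
        using N(2) by (intro sum.cong) (auto simp: F_eq)
      finally show ?thesis ..
    qed
    define X where "X = (2 + K) * gradLinf powr ((real ?d - 1) / real ?d) * gradL1 powr (1 / real ?d)"
    have X: "0 \<le> X" using K by (simp add: X_def)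
    \<comment> \<open>the infimum defining \<open>W\<close> need not be attained, so both bounds
      are proved for every \<open>r > W\<close> and pass to the limit\<close>
    have above: "E \<le> X * r \<and> 1 \<le> real N * (\<omega> * r ^ ?d)" if r: "W < r" for r
    proof -
      have r0: "0 < r" using r W by simp
      have "W_inf cube_measure ?\<nu> < ennreal r" unfolding W(2) using r W by (simp add: ennreal_less_iff)
      then obtain \<pi> where \<pi>: "\<pi> \<in> couplings cube_measure ?\<nu>"
        and es: "esssup \<pi> (\<lambda>(x, y). ennreal (norm (x - y))) < ennreal r"
        unfolding W_inf_def INF_less_iff by blast
      have AE: "AE p in \<pi>. norm (fst p - snd p) \<le> r"
        using esssup_AE[of "\<lambda>(x, y). ennreal (norm (x - y))" \<pi>]
      proof eventually_elim
        case (elim p)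
        then have "ennreal (norm (fst p - snd p)) \<le> ennreal r"
          using es by (auto simp: case_prod_beta)
        then show ?case using r0 by (simp add: ennreal_le_iff)
      qed
      have "E \<le> r * (2 * gradLinf * \<delta> + K * gradL1 * (\<delta> / \<delta> ^ ?d))" if "0 < \<delta>" "\<delta> \<le> 1" for \<delta>
        using transport_bound_scale[OF \<pi> sets_empirical_measure r0 AE that]
        unfolding E_def If I\<nu> by (simp add: transport_const_def K_def \<omega>_def)
      then have "E \<le> (2 + K) * gradLinf powr ((real ?d - 1) / real ?d) * gradL1 powr (1 / real ?d) * r"
        using gradL1_bounds r0 K by (intro optimise_scale) (auto simp: Suc_le_eq)
      then show ?thesis
        using coupling_lower_bound[OF N \<pi> r0 AE] by (simp add: X_def \<omega>_def)
    qed
    have ev: "\<forall>\<^sub>F r in at_right W. W < r" by (simp add: eventually_at_right_less)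
    have "E \<le> X * W"
    proof (rule tendsto_lowerbound)
      show "((\<lambda>r. X * r) \<longlongrightarrow> X * W) (at_right W)" by (intro tendsto_intros)
      show "\<forall>\<^sub>F r in at_right W. E \<le> X * r" using ev by eventually_elim (use above in blast)
    qed simp
    moreover have "1 \<le> real N * (\<omega> * W ^ ?d)"
    proof (rule tendsto_lowerbound)
      show "((\<lambda>r. real N * (\<omega> * r ^ ?d)) \<longlongrightarrow> real N * (\<omega> * W ^ ?d)) (at_right W)" by (intro tendsto_intros)
      show "\<forall>\<^sub>F r in at_right W. 1 \<le> real N * (\<omega> * r ^ ?d)" using ev by eventually_elim (use above in blast)
    qed simp
    then have one: "1 \<le> \<omega> powr (1 / real ?d) * real N powr (1 / real ?d) * W"
    proof -
      assume *: "1 \<le> real N * (\<omega> * W ^ ?d)"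
      have "W \<noteq> 0" using * by (auto simp: power_0_left)
      then have W0: "0 < W" using W by simp
      have "1 \<le> (real N * (\<omega> * W ^ ?d)) powr (1 / real ?d)"
        using * by (intro ge_one_powr_ge_zero) auto
      also have "\<dots> = real N powr (1 / real ?d) * (\<omega> powr (1 / real ?d) * (W ^ ?d) powr (1 / real ?d))"
        using \<omega> W0 by (simp add: powr_mult)
      also have "(W ^ ?d) powr (1 / real ?d) = W"
        using W0 by (simp add: powr_powr flip: powr_realpow)
      finally show ?thesis by (simp add: mult_ac)
    qed
    \<comment> \<open>the second factor of \<open>W\<close> enters here, together with the
      dependence on \<open>N\<close>\<close>
    have "X * W \<le> X * W * (\<omega> powr (1 / real ?d) * real N powr (1 / real ?d) * W)"
      using X W one mult_left_mono[OF one, of "X * W"] by simp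
    also have "\<dots> = c * gradLinf powr ((real ?d - 1) / real ?d) * gradL1 powr (1 / real ?d) * real N powr (1 / real ?d) * W\<^sup>2"
      by (simp add: X_def c_def power2_eq_square mult_ac)
    finally have "E \<le> c * gradLinf powr ((real ?d - 1) / real ?d) * gradL1 powr (1 / real ?d) * real N powr (1 / real ?d) * W\<^sup>2"
      using \<open>E \<le> X * W\<close> by linarith
    then show ?thesis unfolding E_def gradLinf_def W_def L1_norm_gradient .
  qed
  ultimately show ?thesis by blast
qed

end
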